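(* Let $B$ be a classical crystal of type $E_6$. Suppose there exists a bijection $p:B\to B$ that is a twisted isomorphism (induced by an automorphism of the $E_6^{(1)}$ Dynkin diagram) satisfying $p\circ f_1=f_6\circ p$, and suppose that $p$ has order three. Then there exists a combinatorial affine structure on $B$; this structure is given by defining $f_0$ to be $p^2\circ f_1\circ p$.
   Context: The $E_6^{(1)}$ Dynkin diagram has nodes $0,1,\dots,6$ and edges $1-3$, $3-4$, $4-5$, $5-6$, $4-2$, $2-0$; removing node $0$ gives $E_6$ with index set $I=\{1,\dots,6\}$. A classical crystal of type $E_6$ is the crystal (graph) of a finite-dimensional $U_q(E_6)$-module, i.e. a disjoint union of highest weight crystals $B(\lambda)$, with crystal operators $e_i,f_i:B\to B\cup\{\mathbf 0\}$, $i\in I$, viewed as a directed graph with an arrow $b\to f_i(b)$ labelled $i$ whenever $f_i(b)\neq\mathbf 0$. Twisted isomorphism: let $\dot p$ be an automorphism of the affine Dynkin diagram. A bijection $p:B\cup\{\mathbf 0\}\to B'\cup\{\mathbf 0\}$ between classical crystals is a twisted isomorphism induced by $\dot p$ if $p(b)=\mathbf 0$ iff $b=\mathbf 0$, and $p\circ f_i(b)=f_{\dot p(i)}\circ p(b)$ and $p\circ e_i(b)=e_{\dot p(i)}\circ p(b)$ for all $i\in I\setminus\{\dot p^{-1}(0)\}$ and $b\in B$. A crystal (or edge-labelled directed graph) with index set $I'$ is regular if for every 2-element subset $J\subset I'$, its restriction to the $J$-labelled arrows is a classical rank two crystal, i.e. a crystal graph of a finite-dimensional module for the rank two algebra whose Dynkin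 diagram is the restriction of the given diagram to $J$. A combinatorial affine structure for $B$ is a labelled directed graph $\widetilde B$ on the same nodes as $B$ with the same $I$-arrows and an additional set of $0$-arrows, such that $\widetilde B$ is regular (with index set $\{0,1,\dots,6\}$ and the $E_6^{(1)}$ diagram). *)

theory Defs
  imports
    "HOL-Computational_Algebra.Polynomial"
    "HOL-Computational_Algebra.Fraction_Field"
    "HOL-Library.Function_Algebras"
begin

section \<open>Dynkin diagrams\<close>

text \<open>All diagrams that occur are simply laced; a diagram is a set of edges \<open>{i, j}\<close> on
  natural-number nodes, and its restriction to a node set \<open>J\<close> only consults edges inside \<open>J\<close>.\<close>

type_synonym diagram = "nat set set"

definition E6_nodes :: "nat set" where
  "E6_nodes = {1..6}"

definition affine_E6_nodes :: "nat set" where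
  "affine_E6_nodes = {0..6}"

definition affine_E6 :: diagram where
  "affine_E6 = {{1,3}, {3,4}, {4,5}, {5,6}, {4,2}, {2,0}}"

definition cartan :: "diagram \<Rightarrow> nat \<Rightarrow> nat \<Rightarrow> int" where
  "cartan D i j = (if i = j then 2 else if {i, j} \<in> D then -1 else 0)"

definition diagram_automorphism :: "nat set \<Rightarrow> diagram \<Rightarrow> (nat \<Rightarrow> nat) \<Rightarrow> bool" where
  "diagram_automorphism I D s \<longleftrightarrow>
     bij_betw s I I \<and> (\<forall>i\<in>I. \<forall>j\<in>I. {s i, s j} \<in> D \<longleftrightarrow> {i, j} \<in> D)"


section \<open>The ground field $\mathbb{Q}(q)$\<close>

type_synonym Qq = "rat poly fract"

definition q :: Qq where
  "q = Fract [:0, 1:] 1"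

text \<open>The local ring of rational functions without a pole at \<open>q = 0\<close>.\<close>

definition regular_at_0 :: "Qq set" where
  "regular_at_0 = {Fract a b | a b. poly b 0 \<noteq> 0}"

definition qint :: "nat \<Rightarrow> Qq" where
  "qint n = (q powi int n - q powi (- int n)) / (q - inverse q)"

definition qfact :: "nat \<Rightarrow> Qq" where
  "qfact n = (\<Prod>j=1..n. qint j)"


section \<open>Finite-dimensional $U_q(\mathfrak{g})$-modules\<close>

text \<open>Modules are finite-dimensional subspaces of the vector space of all functions
  \<open>nat \<Rightarrow> Qq\<close>. Every finite-dimensional vector space over \<open>Qq\<close> is isomorphic to such a subspace,
  so fixing the ambient space loses nothing; it is needed because types cannot be quantified.\<close>

type_synonym qvec = "nat \<Rightarrow> Qq"

definition scl :: "Qq \<Rightarrow> qvec \<Rightarrow> qvec" where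
  "scl c v = (\<lambda>n. c * v n)"

global_interpretation qvs: vector_space scl
  by standard (auto simp: scl_def fun_eq_iff algebra_simps)

definition weight_vectors :: "nat set \<Rightarrow> (nat \<Rightarrow> qvec \<Rightarrow> qvec) \<Rightarrow> qvec set" where
  "weight_vectors I K =
     {x. \<exists>w :: nat \<Rightarrow> int. \<forall>i\<in>I. K i x = scl (q powi w i) x}"

text \<open>\<open>X\<close> is the sum of its intersections with the weight spaces.\<close>

definition weight_graded :: "nat set \<Rightarrow> (nat \<Rightarrow> qvec \<Rightarrow> qvec) \<Rightarrow> qvec set \<Rightarrow> bool" where
  "weight_graded I K X \<longleftrightarrow>
     (\<forall>x\<in>X. \<exists>W. finite W \<and> W \<subseteq> X \<inter> weight_vectors I K \<and> x = \<Sum>W)"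

definition quantum_serre ::
  "nat set \<Rightarrow> diagram \<Rightarrow> qvec set \<Rightarrow> (nat \<Rightarrow> qvec \<Rightarrow> qvec) \<Rightarrow> bool" where
  "quantum_serre I D V X \<longleftrightarrow>
     (\<forall>i\<in>I. \<forall>j\<in>I. i \<noteq> j \<longrightarrow> (\<forall>x\<in>V.
        let m = nat (1 - cartan D i j) in
        (\<Sum>k\<le>m. scl ((-1) ^ k * (qfact m / (qfact k * qfact (m - k))))
            ((X i ^^ (m - k)) (X j ((X i ^^ k) x)))) = 0))"

text \<open>\<open>V\<close> with Chevalley generators \<open>E i\<close>, \<open>F i\<close>, Cartan generators \<open>K i\<close> and their inverses
  \<open>K' i\<close> (for \<open>i \<in> I\<close>) is a finite-dimensional module over \<open>U\<^sub>q(\<gg>)\<close>, where \<open>\<gg>\<close> has as Dynkin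
  diagram the restriction of \<open>D\<close> to \<open>I\<close>. As usual in crystal theory, modules are of type 1:
  direct sums of weight spaces on which \<open>K i\<close> acts by an integral power of \<open>q\<close>.\<close>

definition Uq_module ::
  "nat set \<Rightarrow> diagram \<Rightarrow> qvec set \<Rightarrow> (nat \<Rightarrow> qvec \<Rightarrow> qvec) \<Rightarrow> (nat \<Rightarrow> qvec \<Rightarrow> qvec) \<Rightarrow>
   (nat \<Rightarrow> qvec \<Rightarrow> qvec) \<Rightarrow> (nat \<Rightarrow> qvec \<Rightarrow> qvec) \<Rightarrow> bool" where
  "Uq_module I D V E F K K' \<longleftrightarrow>
     (\<exists>S. finite S \<and> V = qvs.span S) \<and>
     (\<forall>i\<in>I. \<forall>X\<in>{E i, F i, K i, K' i}. Vector_Spaces.linear scl scl X \<and> X ` V \<subseteq> V) \<and>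
     (\<forall>i\<in>I. \<forall>x\<in>V. K i (K' i x) = x \<and> K' i (K i x) = x) \<and>
     (\<forall>i\<in>I. \<forall>j\<in>I. \<forall>x\<in>V.
        K i (K j x) = K j (K i x) \<and>
        K i (E j x) = scl (q powi cartan D i j) (E j (K i x)) \<and>
        K i (F j x) = scl (q powi (- cartan D i j)) (F j (K i x)) \<and>
        E i (F j x) - F j (E i x) =
          (if i = j then scl (1 / (q - inverse q)) (K i x - K' i x) else 0)) \<and>
     quantum_serre I D V E \<and>
     quantum_serre I D V F \<and>
     weight_graded I K V"


section \<open>Crystal bases at \<open>q = 0\<close>\<close>

definition divided_power :: "(qvec \<Rightarrow> qvec) \<Rightarrow> nat \<Rightarrow> qvec \<Rightarrow> qvec" where
  "divided_power X k x = scl (inverse (qfact k)) ((X ^^ k) x)"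

text \<open>The $\mathfrak{sl}_2$-string decomposition of a vector \<open>x\<close> in direction \<open>i\<close>: \<open>x\<close> is the sum
  of the \<open>F\<^sup>(\<^sup>k\<^sup>) u n k\<close> with \<open>u n k\<close> annihilated by \<open>E\<close> and of \<open>K\<close>-weight \<open>n \<ge> k\<close>. The range
  \<open>k \<le> n\<close> makes the \<open>u n k\<close> unique; not fixing the weight of \<open>x\<close> extends Kashiwara's
  operators linearly from weight vectors to the whole module.\<close>

definition string_decomposition ::
  "qvec set \<Rightarrow> (qvec \<Rightarrow> qvec) \<Rightarrow> (qvec \<Rightarrow> qvec) \<Rightarrow> (qvec \<Rightarrow> qvec) \<Rightarrow> qvec \<Rightarrow>
   nat \<Rightarrow> (nat \<Rightarrow> nat \<Rightarrow> qvec) \<Rightarrow> bool" where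
  "string_decomposition V E F K x N u \<longleftrightarrow>
     (\<forall>n\<le>N. \<forall>k\<le>n. u n k \<in> V \<and> E (u n k) = 0 \<and> K (u n k) = scl (q powi int n) (u n k)) \<and>
     x = (\<Sum>n\<le>N. \<Sum>k\<le>n. divided_power F k (u n k))"

definition kashiwara_f ::
  "qvec set \<Rightarrow> (qvec \<Rightarrow> qvec) \<Rightarrow> (qvec \<Rightarrow> qvec) \<Rightarrow> (qvec \<Rightarrow> qvec) \<Rightarrow> qvec \<Rightarrow> qvec" where
  "kashiwara_f V E F K x =
     (THE y. \<exists>N u. string_decomposition V E F K x N u \<and>
        y = (\<Sum>n\<le>N. \<Sum>k\<le>n. divided_power F (k + 1) (u n k)))"

definition kashiwara_e ::
  "qvec set \<Rightarrow> (qvec \<Rightarrow> qvec) \<Rightarrow> (qvec \<Rightarrow> qvec) \<Rightarrow> (qvec \<Rightarrow> qvec) \<Rightarrow> qvec \<Rightarrow> qvec" where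
  "kashiwara_e V E F K x =
     (THE y. \<exists>N u. string_decomposition V E F K x N u \<and>
        y = (\<Sum>n\<le>N. \<Sum>k=1..n. divided_power F (k - 1) (u n k)))"

text \<open>The second condition says that \<open>L\<close> is a free module over the local ring whose extension of
  scalars to \<open>Qq\<close> is \<open>V\<close>.\<close>

definition crystal_lattice ::
  "nat set \<Rightarrow> qvec set \<Rightarrow> (nat \<Rightarrow> qvec \<Rightarrow> qvec) \<Rightarrow> (nat \<Rightarrow> qvec \<Rightarrow> qvec) \<Rightarrow>
   (nat \<Rightarrow> qvec \<Rightarrow> qvec) \<Rightarrow> qvec set \<Rightarrow> bool" where
  "crystal_lattice I V E F K L \<longleftrightarrow>
     weight_graded I K L \<and>
     (\<exists>S. finite S \<and> qvs.independent S \<and> qvs.span S = V \<and>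
        L = {\<Sum>s\<in>S. scl (a s) s | a. a ` S \<subseteq> regular_at_0}) \<and>
     (\<forall>i\<in>I. \<forall>x\<in>L. kashiwara_e V (E i) (F i) (K i) x \<in> L \<and> kashiwara_f V (E i) (F i) (K i) x \<in> L)"

text \<open>A crystal base \<open>(L, B)\<close>, where the basis elements \<open>b \<in> B\<close> of the rational vector space
  \<open>L / q L\<close> are given through representatives \<open>v b \<in> L\<close>; membership in \<open>q L\<close> thus expresses
  equality in \<open>L / q L\<close>. The induced operators are \<open>e i, f i : B \<rightarrow> B \<union> {0}\<close>,
  with \<open>None\<close> in the role of \<open>0\<close>.\<close>

definition crystal_base ::
  "nat set \<Rightarrow> qvec set \<Rightarrow> (nat \<Rightarrow> qvec \<Rightarrow> qvec) \<Rightarrow> (nat \<Rightarrow> qvec \<Rightarrow> qvec) \<Rightarrow>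
   (nat \<Rightarrow> qvec \<Rightarrow> qvec) \<Rightarrow> qvec set \<Rightarrow> 'b set \<Rightarrow> ('b \<Rightarrow> qvec) \<Rightarrow>
   (nat \<Rightarrow> 'b \<Rightarrow> 'b option) \<Rightarrow> (nat \<Rightarrow> 'b \<Rightarrow> 'b option) \<Rightarrow> bool" where
  "crystal_base I V E F K L B v e f \<longleftrightarrow>
     crystal_lattice I V E F K L \<and>
     finite B \<and>
     (\<forall>b\<in>B. v b \<in> L \<inter> weight_vectors I K) \<and>
     (\<forall>x\<in>L. \<exists>c :: 'b \<Rightarrow> rat. x - (\<Sum>b\<in>B. scl (of_rat (c b)) (v b)) \<in> scl q ` L) \<and>
     (\<forall>c :: 'b \<Rightarrow> rat. (\<Sum>b\<in>B. scl (of_rat (c b)) (v b)) \<in> scl q ` L \<longrightarrow> (\<forall>b\<in>B. c b = 0)) \<and>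
     (\<forall>i\<in>I. \<forall>b\<in>B.
        (case e i b of
           None \<Rightarrow> kashiwara_e V (E i) (F i) (K i) (v b) \<in> scl q ` L
         | Some b' \<Rightarrow> b' \<in> B \<and> kashiwara_e V (E i) (F i) (K i) (v b) - v b' \<in> scl q ` L) \<and>
        (case f i b of
           None \<Rightarrow> kashiwara_f V (E i) (F i) (K i) (v b) \<in> scl q ` L
         | Some b' \<Rightarrow> b' \<in> B \<and> kashiwara_f V (E i) (F i) (K i) (v b) - v b' \<in> scl q ` L)) \<and>
     (\<forall>i\<in>I. \<forall>b\<in>B. \<forall>b'\<in>B. f i b = Some b' \<longleftrightarrow> e i b' = Some b)"


section \<open>Classical crystals and affine structures\<close>

definition classical_crystal ::
  "nat set \<Rightarrow> diagram \<Rightarrow> 'b set \<Rightarrow> (nat \<Rightarrow> 'b \<Rightarrow> 'b option) \<Rightarrow> (nat \<Rightarrow> 'b \<Rightarrow> 'b option) \<Rightarrow> bool" where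
  "classical_crystal I D B e f \<longleftrightarrow>
     (\<exists>V E F K K' L v. Uq_module I D V E F K K' \<and> crystal_base I V E F K L B v e f)"

definition E6_crystal ::
  "'b set \<Rightarrow> (nat \<Rightarrow> 'b \<Rightarrow> 'b option) \<Rightarrow> (nat \<Rightarrow> 'b \<Rightarrow> 'b option) \<Rightarrow> bool" where
  "E6_crystal B e f \<longleftrightarrow> classical_crystal E6_nodes affine_E6 B e f"

definition arrows :: "'b set \<Rightarrow> ('b \<Rightarrow> 'b option) \<Rightarrow> ('b \<times> 'b) set" where
  "arrows B g = {(b, b'). b \<in> B \<and> g b = Some b'}"

text \<open>A labelled directed graph on the node set \<open>B\<close> is given by its arrow sets \<open>G i\<close>,
  one for each label \<open>i\<close>.\<close>

definition regular_graph :: "nat set \<Rightarrow> diagram \<Rightarrow> 'b set \<Rightarrow> (nat \<Rightarrow> ('b \<times> 'b) set) \<Rightarrow> bool" where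
  "regular_graph I D B G \<longleftrightarrow>
     (\<forall>J\<subseteq>I. card J = 2 \<longrightarrow>
        (\<exists>e f. classical_crystal J D B e f \<and> (\<forall>i\<in>J. G i = arrows B (f i))))"

definition combinatorial_affine_structure ::
  "'b set \<Rightarrow> (nat \<Rightarrow> 'b \<Rightarrow> 'b option) \<Rightarrow> (nat \<Rightarrow> ('b \<times> 'b) set) \<Rightarrow> bool" where
  "combinatorial_affine_structure B f G \<longleftrightarrow>
     (\<forall>i\<in>E6_nodes. G i = arrows B (f i)) \<and> regular_graph affine_E6_nodes affine_E6 B G"

text \<open>Maps \<open>p : B \<union> {0} \<rightarrow> B' \<union> {0}\<close> sending exactly \<open>0\<close> to \<open>0\<close> are represented by their
  restriction to \<open>B\<close>, the extension being \<open>map_option p\<close>.\<close>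

definition twisted_isomorphism ::
  "(nat \<Rightarrow> nat) \<Rightarrow> ('b \<Rightarrow> 'c) \<Rightarrow>
   'b set \<Rightarrow> (nat \<Rightarrow> 'b \<Rightarrow> 'b option) \<Rightarrow> (nat \<Rightarrow> 'b \<Rightarrow> 'b option) \<Rightarrow>
   'c set \<Rightarrow> (nat \<Rightarrow> 'c \<Rightarrow> 'c option) \<Rightarrow> (nat \<Rightarrow> 'c \<Rightarrow> 'c option) \<Rightarrow> bool" where
  "twisted_isomorphism s p B e f B' e' f' \<longleftrightarrow>
     bij_betw p B B' \<and>
     (\<forall>i\<in>E6_nodes. s i \<noteq> 0 \<longrightarrow> (\<forall>b\<in>B.
        map_option p (f i b) = f' (s i) (p b) \<and>
        map_option p (e i b) = e' (s i) (p b)))"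

definition has_order_on :: "'b set \<Rightarrow> ('b \<Rightarrow> 'b) \<Rightarrow> nat \<Rightarrow> bool" where
  "has_order_on B p n \<longleftrightarrow>
     0 < n \<and> (\<forall>b\<in>B. (p ^^ n) b = b) \<and> (\<forall>m. 0 < m \<and> m < n \<longrightarrow> (\<exists>b\<in>B. (p ^^ m) b \<noteq> b))"

end

theory Submission
  imports Defs
begin

text \<open>
  A permutation \<open>s\<close> of the nodes that preserves the affine diagram permutes its three leaves
  \<open>0, 1, 6\<close>. The interesting case is \<open>s : 1 \<mapsto> 6 \<mapsto> 0 \<mapsto> 1\<close>. Then \<open>p\<close> carries the candidate
  arrows \<open>f\<^sub>0 = p\<^sup>2 \<circ> f\<^sub>1 \<circ> p\<close> to the arrows \<open>f\<^sub>1\<close>, and \<open>p\<^sup>2\<close> carries them to the arrows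
  \<open>f\<^sub>6\<close>. For a pair \<open>{0, j}\<close> one of \<open>p\<close> (if \<open>j \<noteq> 6\<close>) and \<open>p\<^sup>2\<close> (if \<open>j = 6\<close>) moves the
  \<open>{0, j}\<close>-arrows onto the arrows for two nodes of \<open>E\<^sub>6\<close>. There the given module, restricted to the
  two nodes, is a rank two module with the given crystal base; renaming its generators along \<open>s\<close>
  and its basis along \<open>p\<close> shows that the \<open>{0, j}\<close>-arrows form a classical crystal
  (\<open>classical_crystal_transport\<close>). Pairs inside \<open>{1..6}\<close> only need the restriction.

  Every other \<open>s\<close> is degenerate: the intertwining relations together with \<open>p \<circ> f\<^sub>1 = f\<^sub>6 \<circ> p\<close> and
  \<open>p\<^sup>3 = 1\<close> force \<open>f\<^sub>1 = f\<^sub>6\<close> on \<open>B\<close>. That cannot happen unless the crystal has no arrows at all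
  (\<open>E6_crystal_trivial\<close>), and then any pair \<open>{0, j}\<close> can be compared with a pair of nodes of
  \<open>E\<^sub>6\<close> that has the same adjacency.

  The reason for \<open>E6_crystal_trivial\<close> is that \<open>f\<^sub>1\<close> and \<open>f\<^sub>6\<close> change weights by different roots.
  Nonzero weight vectors of the module have weights that also occur in the crystal base
  (\<open>weight_of_basis_element\<close>). If some weight at node \<open>1\<close> is nonzero, there is a basis vector \<open>u\<close>
  whose weight is positive and maximal at node \<open>1\<close> and, given that, maximal at node \<open>6\<close>. It is
  killed by \<open>E\<^sub>1\<close> and \<open>E\<^sub>6\<close>, so Kashiwara's operators send it to \<open>F\<^sub>1 u\<close> and \<open>F\<^sub>6 u\<close>. Now
  \<open>F\<^sub>1 u\<close> does not lie in \<open>q L\<close>, but it would be congruent to \<open>F\<^sub>6 u\<close>, whose weight at node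
  \<open>6\<close> is different (\<open>equal_operators_weight_0\<close>). Hence \<open>K\<^sub>1\<close> acts as the identity. A generator
  \<open>K\<^sub>i\<close> that acts as the identity makes \<open>E\<^sub>j\<close> and \<open>F\<^sub>j\<close> vanish for the neighbours \<open>j\<close> of \<open>i\<close>,
  and then \<open>K\<^sub>j\<close> is the identity too (\<open>K_id_step\<close>), so triviality spreads over the connected
  diagram.

  The definition of Kashiwara's operators by a definite description is only meaningful once string
  decompositions are known to be unique; this is \<open>string_decomposition_unique\<close>. Their existence is
  needed only for the vectors \<open>F\<^sup>k u\<close> with \<open>u\<close> a highest weight vector, where it is evident.
\<close>

section \<open>The field $\mathbb{Q}(q)$, its local ring at $0$, and quantum integers\<close>

(* These rules would rewrite vectors such as 0 to pointwise abstractions when they are met in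
   eta-expanded form. *)
declare zero_fun_apply [simp del] plus_fun_apply [simp del] minus_apply [simp del] uminus_apply [simp del]

lemma q_nonzero [simp]: "q \<noteq> 0"
  by (simp add: q_def Zero_fract_def eq_fract)

lemma one_regular: "1 \<in> regular_at_0"
  unfolding regular_at_0_def One_fract_def by (force intro: exI[of _ 1])

lemma zero_regular: "0 \<in> regular_at_0"
  unfolding regular_at_0_def Zero_fract_def by (force intro: exI[of _ 1])

lemma q_regular: "q \<in> regular_at_0"
  unfolding regular_at_0_def q_def by (force intro: exI[of _ 1])

lemma regular_mult:
  assumes "x \<in> regular_at_0" "y \<in> regular_at_0"
  shows "x * y \<in> regular_at_0"
proof -
  obtain a b c d where "x = Fract a b" "poly b 0 \<noteq> 0" "y = Fract c d" "poly d 0 \<noteq> 0"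
    using assms unfolding regular_at_0_def by blast
  then have "x * y = Fract (a * c) (b * d)" "poly (b * d) 0 \<noteq> 0"
    by auto
  then show ?thesis unfolding regular_at_0_def by blast
qed

lemma regular_add:
  assumes "x \<in> regular_at_0" "y \<in> regular_at_0"
  shows "x + y \<in> regular_at_0"
proof -
  obtain a b c d where "x = Fract a b" "poly b 0 \<noteq> 0" "y = Fract c d" "poly d 0 \<noteq> 0"
    using assms unfolding regular_at_0_def by blast
  moreover from this have "b \<noteq> 0" "d \<noteq> 0" by auto
  ultimately have "x + y = Fract (a * d + c * b) (b * d)" "poly (b * d) 0 \<noteq> 0"
    by auto
  then show ?thesis unfolding regular_at_0_def by blast
qed

lemma minus_1_regular: "-1 \<in> regular_at_0"
  unfolding regular_at_0_def One_fract_def by (force intro: exI[of _ 1])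

lemma inverse_q_not_regular: "inverse q \<notin> regular_at_0"
proof
  assume "inverse q \<in> regular_at_0"
  then obtain a b where "inverse q = Fract a b" and b: "poly b 0 \<noteq> 0"
    unfolding regular_at_0_def by blast
  then have ab: "Fract 1 [:0, 1:] = Fract a b"
    by (simp add: q_def)
  from b have "b \<noteq> 0" by auto
  with ab have "b = a * [:0, 1:]" by (simp add: eq_fract)
  then have "poly b 0 = 0" by simp
  with b show False by simp
qed

text \<open>The local ring is a valuation ring: a common root \<open>0\<close> of numerator and denominator can be
  cancelled until at most one of them vanishes at \<open>0\<close>.\<close>

lemma regular_or_inverse_regular: "x \<in> regular_at_0 \<or> inverse x \<in> regular_at_0"
proof -
  have main: "Fract a b \<in> regular_at_0 \<or> Fract b a \<in> regular_at_0" if "b \<noteq> 0" for a b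
    using that
  proof (induction "degree b" arbitrary: a b rule: less_induct)
    case less
    show ?case
    proof (cases "poly b 0 = 0 \<and> poly a 0 = 0")
      case True
      then obtain a' b' where ab': "a = [:0, 1:] * a'" "b = [:0, 1:] * b'"
        unfolding poly_eq_0_iff_dvd minus_zero dvd_def by blast
      with less.prems have "b' \<noteq> 0" by auto
      moreover have "degree b' < degree b" 
        unfolding ab' using \<open>b' \<noteq> 0\<close> by (subst degree_mult_eq) auto
      ultimately have "Fract a' b' \<in> regular_at_0 \<or> Fract b' a' \<in> regular_at_0"
        using less.hyps by blast
      moreover have "Fract a b = Fract a' b'" "Fract b a = Fract b' a'"
        unfolding ab' by (rule mult_fract_cancel, simp)+
      ultimately show ?thesis by simp
    next
      case False
      then show ?thesis unfolding regular_at_0_def by blast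
    qed
  qed
  show ?thesis
  proof (cases x)
    case (Fract a b)
    then show ?thesis using main[of b a] by auto
  qed
qed

text \<open>Among finitely many elements of the fraction field of a valuation ring there is one that
  divides all the others.\<close>

lemma dominant_coefficient:
  fixes a :: "'s \<Rightarrow> Qq"
  assumes "finite S" "\<exists>s\<in>S. a s \<noteq> 0"
  shows "\<exists>t\<in>S. a t \<noteq> 0 \<and> (\<forall>s\<in>S. a s / a t \<in> regular_at_0)"
  using assms
proof (induction S rule: finite_induct)
  case (insert r S)
  show ?case
  proof (cases "\<exists>s\<in>S. a s \<noteq> 0")
    case True
    with insert.IH obtain t where t: "t \<in> S" "a t \<noteq> 0" "\<forall>s\<in>S. a s / a t \<in> regular_at_0" by blast
    consider "a r / a t \<in> regular_at_0" | "a r \<noteq> 0" "a t / a r \<in> regular_at_0"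
      using regular_or_inverse_regular[of "a r / a t"] zero_regular
      by (metis div_0 inverse_divide)
    then show ?thesis
    proof cases
      case 1
      with t show ?thesis by blast
    next
      case 2
      have "a s / a r \<in> regular_at_0" if "s \<in> S" for s
      proof -
        have "a s / a r = (a s / a t) * (a t / a r)"
          using t(2) by (metis nonzero_eq_divide_eq times_divide_eq_right)
        then show ?thesis using regular_mult 2(2) t(3) that by metis
      qed
      moreover have "a r / a r \<in> regular_at_0"
        using 2(1) one_regular by (metis divide_self)
      ultimately show ?thesis using 2(1) by blast
    qed
  next
    case False
    with insert.prems have "a r \<noteq> 0" by blast
    then have "a s / a r \<in> regular_at_0" if "s \<in> insert r S" for s
      using False that zero_regular one_regular by (metis insertE div_0 divide_self)
    with \<open>a r \<noteq> 0\<close> show ?thesis by blast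
  qed
qed blast

lemma q_power_regular: "q ^ n \<in> regular_at_0"
  by (induction n) (auto intro: one_regular regular_mult q_regular)

text \<open>If a positive power of \<open>q\<close> were \<open>1\<close>, then \<open>q\<close> would be invertible in the local ring.
  So different integral weights are different eigenvalues.\<close>

lemma q_powi_eq_1_iff [simp]: "q powi m = 1 \<longleftrightarrow> m = 0"
proof
  have pos: "q ^ n \<noteq> 1" if "n > 0" for n
  proof
    assume "q ^ n = 1"
    with that have "q * q ^ (n - 1) = 1"
      by (simp flip: power_Suc)
    then have "inverse q = q ^ (n - 1)"
      by (rule inverse_unique)
    with q_power_regular inverse_q_not_regular show False by metis
  qed
  assume m: "q powi m = 1"
  show "m = 0"
  proof (rule ccontr)
    assume "m \<noteq> 0"
    then have "nat \<bar>m\<bar> > 0" by simp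
    moreover have "q ^ nat \<bar>m\<bar> = 1"
      using m by (cases "m \<ge> 0") (auto simp: power_int_def power_inverse)
    ultimately show False using pos by blast
  qed
qed simp

lemma q_powi_inject [simp]: "q powi m = q powi n \<longleftrightarrow> m = n"
proof
  assume "q powi m = q powi n"
  then have "q powi (m - n) = 1" by (simp add: power_int_diff)
  then show "m = n" by simp
qed simp

text \<open>The quantum integers for all integers; the weights of vectors that are not yet known to be
  dominant need the negative ones.\<close>

definition qnum :: "int \<Rightarrow> Qq" where
  "qnum m = (q powi m - q powi (- m)) / (q - inverse q)"

lemma q_neq_inverse [simp]: "q \<noteq> inverse q"
  using q_powi_inject[of 1 "-1"] by (simp add: power_int_minus del: q_powi_inject)

lemma qnum_eq_0_iff [simp]: "qnum m = 0 \<longleftrightarrow> m = 0"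
proof -
  have "m = - m \<longleftrightarrow> m = 0" by presburger
  then show ?thesis by (simp add: qnum_def)
qed

lemma qnum_1: "qnum 1 = 1"
  by (simp add: qnum_def power_int_minus)

lemma qint_eq_qnum: "qint n = qnum (int n)"
  by (simp add: qint_def qnum_def)

lemma qfact_nonzero [simp]: "qfact n \<noteq> 0"
  by (simp add: qfact_def qint_eq_qnum)

lemma qfact_Suc: "qfact (Suc n) = qnum (int (Suc n)) * qfact n"
  by (simp add: qfact_def qint_eq_qnum prod.nat_ivl_Suc' mult.commute)

lemma qnum_identity_aux:
  fixes x y q :: "'a :: field"
  assumes "x * x' = 1"
  shows "(x - x') * (y * x' * q - y' * x * q') + (y * x' * x' - y' * x * x) * (q - q')
     = (x * q - x' * q') * (y * x' - y' * x)"
proof -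
  have "x \<noteq> 0" "x' = inverse x"
    using assms by (auto simp: inverse_unique)
  then show ?thesis
    by (simp add: field_simps)
qed

lemma frac_identity:
  fixes a b c d a' b' :: "'a :: field"
  assumes "d \<noteq> 0" "a * b + c * d = a' * b'"
  shows "a / d * (b / d) + c / d = a' / d * (b' / d)"
  unfolding times_divide_times_eq assms(2)[symmetric] add_divide_distrib using assms(1) by simp

lemma q_powi_add: "q powi (m + n) = q powi m * q powi n"
  by (rule power_int_add) simp

lemma q_powi_diff: "q powi (m - n) = q powi m * q powi (- n)"
  by (simp only: q_powi_add diff_conv_add_uminus)

lemma q_powi_1: "q powi 1 = q" "q powi (-1) = inverse q"
  by (rule power_int_1_right, rule power_int_minus1_right)

lemma q_powi_times_minus: "q powi k * q powi (- k) = 1"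
  by (simp add: power_int_minus)

text \<open>The inductive step in the computation of \<open>E F\<^sup>k u\<close> for a highest weight vector \<open>u\<close>.\<close>

lemma qnum_identity: "qnum k * qnum (n - k + 1) + qnum (n - 2 * k) = qnum (k + 1) * qnum (n - k)"
proof -
  define d where "d = q - inverse q"
  have nz: "d \<noteq> 0" unfolding d_def by simp
  have qnum: "qnum m = (q powi m - q powi (- m)) / d" for m
    unfolding d_def by (rule qnum_def)
  have minus: "- (n - k + 1) = - n + k + -1" "n - 2 * k = n + - k + - k" "- (n + - k + - k) = - n + k + k"
    "- (k + 1) = - k + -1" "- (n - k) = - n + k"
    by simp_all
  show ?thesis
    unfolding qnum
  proof (rule frac_identity[OF nz])
    show "(q powi k - q powi - k) * (q powi (n - k + 1) - q powi - (n - k + 1)) +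
        (q powi (n - 2 * k) - q powi - (n - 2 * k)) * d
      = (q powi (k + 1) - q powi - (k + 1)) * (q powi (n - k) - q powi - (n - k))"
      unfolding minus q_powi_diff[of n k] q_powi_diff[of "n" k] q_powi_add q_powi_1 d_def
      by (rule qnum_identity_aux[OF q_powi_times_minus])
  qed
qed

section \<open>Linear operators and their eigenvectors\<close>

abbreviation qlinear :: "(qvec \<Rightarrow> qvec) \<Rightarrow> bool" where
  "qlinear \<equiv> Vector_Spaces.linear scl scl"

lemma qlinear_module_hom: "qlinear X \<Longrightarrow> module_hom scl scl X"
  by (rule Vector_Spaces.linear.axioms(3))

lemmas qlinear_add = module_hom.add[OF qlinear_module_hom]
  and qlinear_diff = module_hom.diff[OF qlinear_module_hom]
  and qlinear_scale = module_hom.scale[OF qlinear_module_hom]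
  and qlinear_zero = module_hom.zero[OF qlinear_module_hom]
  and qlinear_sum = module_hom.sum[OF qlinear_module_hom]

lemma qlinear_funpow:
  assumes "qlinear X"
  shows "qlinear (X ^^ k)"
proof (induction k)
  case 0
  show ?case unfolding funpow_0 funpow.simps(1) by (rule qvs.linear_id)
next
  case (Suc k)
  then show ?case unfolding funpow.simps(2) by (rule Vector_Spaces.linear_compose[OF _ assms])
qed

text \<open>Apply \<open>T - q\<^sup>m\<close> to the relation, where \<open>m\<close> is one of the exponents: this removes one summand
  and rescales the others by nonzero factors.\<close>

lemma eigenvectors_independent:
  assumes "qlinear T" "finite M" "\<forall>m\<in>M. T (z m) = scl (q powi m) (z m)" "(\<Sum>m\<in>M. z m) = 0"
  shows "\<forall>m\<in>M. z m = 0"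
  using assms(2,3,4)
proof (induction M arbitrary: z rule: finite_induct)
  case (insert m0 M)
  define y where "y m = scl (q powi m - q powi m0) (z m)" for m
  have "(\<Sum>m\<in>M. y m) = (\<Sum>m\<in>insert m0 M. y m)"
    using insert.hyps by (simp add: y_def)
  also have "\<dots> = (\<Sum>m\<in>insert m0 M. T (z m) - scl (q powi m0) (z m))"
    using insert.prems by (intro sum.cong) (auto simp: y_def qvs.scale_left_diff_distrib)
  also have "\<dots> = T (\<Sum>m\<in>insert m0 M. z m) - scl (q powi m0) (\<Sum>m\<in>insert m0 M. z m)"
    by (simp only: sum_subtractf qlinear_sum[OF assms(1)] qvs.scale_sum_right)
  also have "\<dots> = 0"
    by (simp only: insert.prems(2) qlinear_zero[OF assms(1)] qvs.scale_zero_right diff_self)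
  finally have "(\<Sum>m\<in>M. y m) = 0" .
  moreover have "\<forall>m\<in>M. T (y m) = scl (q powi m) (y m)"
  proof
    fix m assume "m \<in> M"
    then have "T (z m) = scl (q powi m) (z m)" using insert.prems(1) by blast
    then show "T (y m) = scl (q powi m) (y m)"
      unfolding y_def qlinear_scale[OF assms(1)] by (simp only: qvs.scale_scale mult.commute)
  qed
  ultimately have y0: "\<forall>m\<in>M. y m = 0" using insert.IH by blast
  have z: "z m = 0" if "m \<in> M" for m
  proof -
    have "m \<noteq> m0" using insert.hyps that by blast
    then have "q powi m - q powi m0 \<noteq> 0" by simp
    moreover have "scl (q powi m - q powi m0) (z m) = 0" using y0 that unfolding y_def by blast
    ultimately show ?thesis unfolding qvs.scale_eq_0_iff by blast
  qed
  have "(\<Sum>m\<in>M. z m) = 0"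
    using z by (intro sum.neutral) blast
  then have "z m0 = (\<Sum>m\<in>insert m0 M. z m)"
    by (simp only: sum.insert[OF insert.hyps] add_0_right)
  then have "z m0 = 0"
    using insert.prems(2) by (rule trans)
  with z show ?case by blast
next
  case empty
  show ?case by blast
qed

section \<open>Finite-dimensional modules of rank one\<close>

text \<open>The part of a module structure that concerns a single node.\<close>

locale Uq_sl2 =
  fixes V :: "qvec set" and E F K K' :: "qvec \<Rightarrow> qvec"
  assumes subspace: "qvs.subspace V"
    and lin_E: "qlinear E" and lin_F: "qlinear F" and lin_K: "qlinear K" and lin_K': "qlinear K'"
    and E_closed: "x \<in> V \<Longrightarrow> E x \<in> V" and F_closed: "x \<in> V \<Longrightarrow> F x \<in> V"
    and K'_closed: "x \<in> V \<Longrightarrow> K' x \<in> V"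
    and K_K': "x \<in> V \<Longrightarrow> K (K' x) = x" and K'_K: "x \<in> V \<Longrightarrow> K' (K x) = x"
    and K_E: "x \<in> V \<Longrightarrow> K (E x) = scl (q powi 2) (E (K x))"
    and K_F: "x \<in> V \<Longrightarrow> K (F x) = scl (q powi (-2)) (F (K x))"
    and E_F: "x \<in> V \<Longrightarrow> E (F x) - F (E x) = scl (1 / (q - inverse q)) (K x - K' x)"
begin

lemma K'_weight:
  assumes "x \<in> V" "K x = scl (q powi n) x"
  shows "K' x = scl (q powi (- n)) x"
proof -
  have "x = scl (q powi n) (K' x)"
    using K'_K[OF assms(1)] unfolding assms(2) qlinear_scale[OF lin_K'] by (rule sym)
  then have "scl (q powi (- n)) x = scl (q powi (- n)) (scl (q powi n) (K' x))"
    by (rule arg_cong[where f = "scl (q powi (- n))"])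
  also have "\<dots> = K' x"
    unfolding qvs.scale_scale q_powi_add[symmetric] by simp
  finally show ?thesis by (rule sym)
qed

text \<open>The Chevalley involution. It yields the statements on lowest weight vectors from those on
  highest weight vectors.\<close>

lemma swap_sl2: "Uq_sl2 V F E K' K"
proof (rule Uq_sl2.intro)
  show "K' (F x) = scl (q powi 2) (F (K' x))" if "x \<in> V" for x
  proof -
    have "K (F (K' x)) = scl (q powi (-2)) (F x)"
      using K_F[OF K'_closed[OF that]] K_K'[OF that] by simp
    then have "K' (K (F (K' x))) = scl (q powi (-2)) (K' (F x))"
      by (simp only: qlinear_scale[OF lin_K'])
    then have "F (K' x) = scl (q powi (-2)) (K' (F x))"
      using K'_K[OF F_closed[OF K'_closed[OF that]]] by simp
    then show ?thesis
      by (simp only: qvs.scale_scale q_powi_add[symmetric]) simp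
  qed
  show "K' (E x) = scl (q powi - 2) (E (K' x))" if "x \<in> V" for x
  proof -
    have "K (E (K' x)) = scl (q powi 2) (E x)"
      using K_E[OF K'_closed[OF that]] K_K'[OF that] by simp
    then have "K' (K (E (K' x))) = scl (q powi 2) (K' (E x))"
      by (simp only: qlinear_scale[OF lin_K'])
    then have "E (K' x) = scl (q powi 2) (K' (E x))"
      using K'_K[OF E_closed[OF K'_closed[OF that]]] by simp
    then show ?thesis
      by (simp only: qvs.scale_scale q_powi_add[symmetric]) simp
  qed
  show "F (E x) - E (F x) = scl (1 / (q - inverse q)) (K' x - K x)" if "x \<in> V" for x
  proof -
    have "F (E x) - E (F x) = - (E (F x) - F (E x))" by simp
    also have "\<dots> = scl (1 / (q - inverse q)) (- (K x - K' x))"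
      unfolding E_F[OF that] qvs.scale_minus_right ..
    finally show ?thesis by simp
  qed
  (* The commutator expresses K x by K' x, E and F. *)
  show "K x \<in> V" if "x \<in> V" for x
  proof -
    have "scl (q - inverse q) (E (F x) - F (E x)) = K x - K' x"
      unfolding E_F[OF that] by simp
    moreover have "scl (q - inverse q) (E (F x) - F (E x)) \<in> V"
      using that by (intro qvs.subspace_scale qvs.subspace_diff subspace E_closed F_closed)
    ultimately have "K x - K' x + K' x \<in> V"
      using qvs.subspace_add[OF subspace] K'_closed[OF that] by metis
    then show ?thesis by simp
  qed
qed (use subspace lin_E lin_F lin_K lin_K' E_closed F_closed K_K' K'_K in blast)+

lemma F_power_closed: "x \<in> V \<Longrightarrow> (F ^^ k) x \<in> V"
  by (induction k) (auto intro: F_closed)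

lemma K_F_power:
  assumes "x \<in> V" "K x = scl (q powi n) x"
  shows "K ((F ^^ k) x) = scl (q powi (n - 2 * int k)) ((F ^^ k) x)"
proof (induction k)
  case (Suc k)
  have "K (F ((F ^^ k) x)) = scl (q powi (-2)) (F (K ((F ^^ k) x)))"
    by (rule K_F[OF F_power_closed[OF assms(1)]])
  also have "\<dots> = scl (q powi (-2 + (n - 2 * int k))) (F ((F ^^ k) x))"
    unfolding Suc.IH qlinear_scale[OF lin_F] qvs.scale_scale q_powi_add[symmetric] ..
  also have "-2 + (n - 2 * int k) = n - 2 * int (Suc k)" by simp
  finally show ?case by simp
qed (use assms in simp)

definition highest :: "int \<Rightarrow> qvec \<Rightarrow> bool" where
  "highest n u \<longleftrightarrow> u \<in> V \<and> E u = 0 \<and> K u = scl (q powi n) u"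

lemma subspace_highest: "qvs.subspace {u. highest n u}"
  unfolding highest_def qvs.subspace_def
  using qvs.subspace_add[OF subspace] qvs.subspace_scale[OF subspace] qvs.subspace_0[OF subspace]
  by (auto simp: qlinear_add[OF lin_E] qlinear_add[OF lin_K] qlinear_zero[OF lin_E]
      qlinear_zero[OF lin_K] qlinear_scale[OF lin_E] qlinear_scale[OF lin_K] qvs.scale_right_distrib
      mult.commute)

lemma highest_0 [simp]: "highest n 0"
  using qvs.subspace_0[OF subspace_highest] by blast

lemma highest_scale: "highest n u \<Longrightarrow> highest n (scl c u)"
  using qvs.subspace_scale[OF subspace_highest] by blast

lemma highest_diff: "highest n u \<Longrightarrow> highest n v \<Longrightarrow> highest n (u - v)"
  using qvs.subspace_diff[OF subspace_highest] by blast

lemma E_F_weight: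
  assumes "x \<in> V" "K x = scl (q powi n) x"
  shows "E (F x) = F (E x) + scl (qnum n) x"
proof -
  have "E (F x) - F (E x) = scl (qnum n) x"
    unfolding E_F[OF assms(1)] assms(2) K'_weight[OF assms]
      qvs.scale_left_diff_distrib[symmetric] qvs.scale_scale qnum_def by simp
  then show ?thesis by (simp add: diff_eq_eq add.commute)
qed

text \<open>Moving \<open>E\<close> through \<open>F\<^sup>k\<^sup>+\<^sup>1\<close> leaves one commutator for each factor; the quantum integers
  they contribute add up to a product.\<close>

lemma E_F_power:
  assumes "highest n u"
  shows "E ((F ^^ Suc k) u) = scl (qnum (int k + 1) * qnum (n - int k)) ((F ^^ k) u)"
proof (induction k)
  case 0
  show ?case
    using assms E_F_weight[of u n] unfolding highest_def by (simp add: qlinear_zero[OF lin_F] qnum_1)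
next
  case (Suc k)
  have u: "u \<in> V" "K u = scl (q powi n) u" using assms unfolding highest_def by auto
  have "E (F ((F ^^ Suc k) u)) = F (E ((F ^^ Suc k) u)) + scl (qnum (n - 2 * int (Suc k))) ((F ^^ Suc k) u)"
    by (rule E_F_weight[OF F_power_closed[OF u(1)] K_F_power[OF u]])
  also have "F (E ((F ^^ Suc k) u)) = scl (qnum (int k + 1) * qnum (n - int k)) ((F ^^ Suc k) u)"
    unfolding Suc.IH qlinear_scale[OF lin_F] by simp
  also have "\<dots> + scl (qnum (n - 2 * int (Suc k))) ((F ^^ Suc k) u)
      = scl (qnum (int k + 1) * qnum (n - int k) + qnum (n - 2 * int (Suc k))) ((F ^^ Suc k) u)"
    by (simp only: qvs.scale_left_distrib)
  also have "qnum (int k + 1) * qnum (n - int k) + qnum (n - 2 * int (Suc k))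
      = qnum (int (Suc k) + 1) * qnum (n - int (Suc k))"
    using qnum_identity[of "int k + 1" n] by (simp add: algebra_simps)
  finally show ?case by simp
qed

text \<open>The factors in the formula for \<open>E F\<^sup>k\<^sup>+\<^sup>1 u\<close> do not vanish before \<open>k = n\<close>, so \<open>E\<close> leads back
  to \<open>u\<close>. For negative \<open>n\<close> this covers all \<open>j\<close>.\<close>

lemma F_power_nonzero:
  assumes "highest n u" "u \<noteq> 0" "\<forall>i<j. n \<noteq> int i"
  shows "(F ^^ j) u \<noteq> 0"
  using assms(3)
proof (induction j)
  case (Suc j)
  have "scl (qnum (int j + 1) * qnum (n - int j)) ((F ^^ j) u) \<noteq> 0"
    unfolding qvs.scale_eq_0_iff using Suc by auto
  then show ?case
    unfolding E_F_power[OF assms(1), symmetric] by (metis qlinear_zero[OF lin_E])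
qed (use assms(2) in simp)

lemma divided_power_0: "divided_power F k 0 = 0"
  unfolding divided_power_def qlinear_zero[OF qlinear_funpow[OF lin_F]] by (rule qvs.scale_zero_right)

lemma divided_power_diff: "divided_power F k (x - y) = divided_power F k x - divided_power F k y"
  unfolding divided_power_def qlinear_diff[OF qlinear_funpow[OF lin_F]] by (rule qvs.scale_right_diff_distrib)

lemma E_divided_power:
  assumes "highest n u"
  shows "E (divided_power F (Suc k) u) = scl (qnum (n - int k)) (divided_power F k u)"
  unfolding divided_power_def qlinear_scale[OF lin_E] E_F_power[OF assms] qvs.scale_scale qfact_Suc
  by (simp add: field_simps)

text \<open>Taking \<open>r > 0\<close> gives \<open>0\<close>, so \<open>E\<^sup>j\<close> picks out the summands with \<open>k \<ge> j\<close> of a string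
  decomposition.\<close>

lemma E_power_divided_power:
  assumes "highest n u"
  shows "(E ^^ (r + k)) (divided_power F k u) = scl (\<Prod>i<k. qnum (n - int i)) ((E ^^ r) u)"
proof (induction k)
  case 0
  show ?case by (simp add: divided_power_def qfact_def)
next
  case (Suc k)
  have "(E ^^ (r + Suc k)) (divided_power F (Suc k) u)
      = (E ^^ (r + k)) (E (divided_power F (Suc k) u))"
    by (simp add: funpow_swap1)
  also have "\<dots> = scl (\<Prod>i<Suc k. qnum (n - int i)) ((E ^^ r) u)"
    unfolding E_divided_power[OF assms] qlinear_scale[OF qlinear_funpow[OF lin_E]] Suc.IH by (simp add: mult.commute)
  finally show ?case .
qed

text \<open>Let \<open>j\<close> be the largest \<open>k\<close> with a nonzero component. Applying \<open>E\<^sup>j\<close> kills all smaller \<open>k\<close> and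
  leaves a nonzero multiple of each \<open>d n j\<close>, the factor being nonzero because of \<open>j \<le> n\<close>. These
  vectors have the distinct weights \<open>n\<close> and so vanish separately.\<close>

lemma string_sum_eq_0:
  fixes N :: nat
  assumes hw: "\<forall>n\<le>N. \<forall>k\<le>n. highest (int n) (d n k)"
    and sum0: "(\<Sum>n\<le>N. \<Sum>k\<le>n. divided_power F k (d n k)) = 0"
  shows "\<forall>n\<le>N. \<forall>k\<le>n. d n k = 0"
proof (rule ccontr)
  define S where "S = {k. \<exists>n\<le>N. k \<le> n \<and> d n k \<noteq> 0}"
  define j where "j = Max S"
  assume "\<not> (\<forall>n\<le>N. \<forall>k\<le>n. d n k = 0)"
  then have "S \<noteq> {}" unfolding S_def by blast
  moreover have fin: "finite S"
    by (rule finite_subset[of _ "{..N}"]) (auto simp: S_def)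
  ultimately have "j \<in> S" unfolding j_def by (rule Max_in[rotated])
  have above: "d n k = 0" if "n \<le> N" "k \<le> n" "j < k" for n k
  proof (rule ccontr)
    assume "d n k \<noteq> 0"
    with that have "k \<in> S" unfolding S_def by blast
    then have "k \<le> j" unfolding j_def by (rule Max_ge[OF fin])
    with \<open>j < k\<close> show False by simp
  qed
  define z where "z n = (if j \<le> n then scl (\<Prod>i<j. qnum (int n - int i)) (d n j) else 0)" for n
  note lin = qlinear_funpow[OF lin_E, of j]
  have row: "(E ^^ j) (\<Sum>k\<le>n. divided_power F k (d n k)) = z n" if "n \<le> N" for n
  proof -
    have "(E ^^ j) (\<Sum>k\<le>n. divided_power F k (d n k)) = (\<Sum>k\<le>n. (E ^^ j) (divided_power F k (d n k)))"
      by (rule qlinear_sum[OF lin])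
    also have "\<dots> = (\<Sum>k\<le>n. if k = j then z n else 0)"
    proof (rule sum.cong[OF refl])
      fix k assume "k \<in> {..n}"
      then have k: "k \<le> n" by simp
      with hw that have hwk: "highest (int n) (d n k)" by blast
      consider "k < j" | "k = j" | "j < k" by linarith
      then show "(E ^^ j) (divided_power F k (d n k)) = (if k = j then z n else 0)"
      proof cases
        case 1
        then obtain r where r: "j = Suc r + k" by (metis add.commute add_Suc_right less_imp_Suc_add)
        have "(E ^^ Suc r) (d n k) = 0"
          using hwk unfolding highest_def funpow_Suc_right o_apply
          by (metis qlinear_zero[OF qlinear_funpow[OF lin_E]])
        then have "(E ^^ j) (divided_power F k (d n k)) = 0"
          unfolding r E_power_divided_power[OF hwk] by (metis qvs.scale_zero_right)
        with 1 show ?thesis by (metis less_irrefl)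
      next
        case 2
        then show ?thesis
          using E_power_divided_power[OF hwk, of 0] k by (simp add: z_def)
      next
        case 3
        then have "(E ^^ j) (divided_power F k (d n k)) = 0"
          using above[OF that k] by (metis divided_power_0 qlinear_zero[OF lin])
        with 3 show ?thesis by (metis less_irrefl)
      qed
    qed
    also have "\<dots> = (if j \<in> {..n} then z n else 0)"
      by (rule sum.delta) simp
    also have "\<dots> = z n"
      unfolding z_def by (metis atMost_iff)
    finally show ?thesis .
  qed
  have "(\<Sum>n\<le>N. z n) = (\<Sum>n\<le>N. (E ^^ j) (\<Sum>k\<le>n. divided_power F k (d n k)))"
    by (rule sum.cong) (use row in auto)
  also have "\<dots> = (E ^^ j) 0"
    unfolding qlinear_sum[OF lin, symmetric] sum0 ..
  finally have "(\<Sum>n\<le>N. z n) = 0"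
    by (simp only: qlinear_zero[OF lin])
  then have "(\<Sum>m\<in>int ` {..N}. z (nat m)) = 0"
    by (subst sum.reindex) (simp_all add: o_def)
  moreover have "\<forall>m\<in>int ` {..N}. K (z (nat m)) = scl (q powi m) (z (nat m))"
  proof
    fix m assume "m \<in> int ` {..N}"
    then obtain n where n: "m = int n" "n \<le> N" by auto
    have "highest (int n) (z n)"
      unfolding z_def using highest_scale hw n by simp
    then show "K (z (nat m)) = scl (q powi m) (z (nat m))"
      unfolding highest_def n by simp
  qed
  ultimately have z0: "\<forall>m\<in>int ` {..N}. z (nat m) = 0"
    by (intro eigenvectors_independent[OF lin_K]) auto
  from \<open>j \<in> S\<close> obtain n where n: "n \<le> N" "j \<le> n" "d n j \<noteq> 0" unfolding S_def by blast
  with z0 have "z (nat (int n)) = 0" by blast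
  then have "scl (\<Prod>i<j. qnum (int n - int i)) (d n j) = 0"
    using n(2) unfolding z_def by simp
  then show False
    unfolding qvs.scale_eq_0_iff using n by auto
qed

lemma string_sum_extend:
  fixes N M :: nat and u :: "nat \<Rightarrow> nat \<Rightarrow> qvec"
  assumes "N \<le> M" "\<And>k. G k 0 = (0 :: qvec)"
  shows "(\<Sum>n\<le>M. \<Sum>k\<le>n. G k (if n \<le> N then u n k else 0)) = (\<Sum>n\<le>N. \<Sum>k\<le>n. G k (u n k))"
proof (rule sum.mono_neutral_cong_right)
  show "\<forall>n\<in>{..M} - {..N}. (\<Sum>k\<le>n. G k (if n \<le> N then u n k else 0)) = 0"
    using assms(2) by (auto intro!: sum.neutral)
qed (use assms(1) in auto)

text \<open>Stated for sums of arbitrary maps \<open>G k\<close> fixing \<open>0\<close>, so that it serves both of Kashiwara's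
  operators.\<close>

lemma string_decomposition_unique:
  assumes "string_decomposition V E F K x N u" "string_decomposition V E F K x N' u'"
    and G: "\<And>k. G k 0 = (0 :: qvec)"
  shows "(\<Sum>n\<le>N. \<Sum>k\<le>n. G k (u n k)) = (\<Sum>n\<le>N'. \<Sum>k\<le>n. G k (u' n k))"
proof -
  (* Two decompositions of different lengths are compared after padding both with zeros. *)
  define M v v' where "M = max N N'" and "v n k = (if n \<le> N then u n k else 0)"
    and "v' n k = (if n \<le> N' then u' n k else 0)" for n k
  have hw: "\<forall>n\<le>M. \<forall>k\<le>n. highest (int n) (v n k - v' n k)"
  proof (intro allI impI highest_diff)
    fix n k :: nat assume "k \<le> n"
    then show "highest (int n) (v n k)"
      using assms(1) highest_0 unfolding string_decomposition_def v_def by (auto simp: highest_def)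
    show "highest (int n) (v' n k)"
      using \<open>k \<le> n\<close> assms(2) highest_0 unfolding string_decomposition_def v'_def by (auto simp: highest_def)
  qed
  have ext: "(\<Sum>n\<le>M. \<Sum>k\<le>n. G k (v n k)) = (\<Sum>n\<le>N. \<Sum>k\<le>n. G k (u n k))"
    "(\<Sum>n\<le>M. \<Sum>k\<le>n. G k (v' n k)) = (\<Sum>n\<le>N'. \<Sum>k\<le>n. G k (u' n k))"
    if "\<And>k. G k 0 = (0 :: qvec)" for G
    unfolding v_def v'_def M_def using that by (simp_all add: string_sum_extend)
  have "(\<Sum>n\<le>M. \<Sum>k\<le>n. divided_power F k (v n k - v' n k))
      = (\<Sum>n\<le>M. \<Sum>k\<le>n. divided_power F k (v n k)) - (\<Sum>n\<le>M. \<Sum>k\<le>n. divided_power F k (v' n k))"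
    by (simp only: divided_power_diff sum_subtractf)
  also have "\<dots> = x - x"
    unfolding ext[of "divided_power F", OF divided_power_0]
    using assms(1,2) unfolding string_decomposition_def by metis
  finally have "\<forall>n\<le>M. \<forall>k\<le>n. v n k - v' n k = 0"
    by (intro string_sum_eq_0[OF hw]) (simp only: diff_self)
  then have "(\<Sum>n\<le>M. \<Sum>k\<le>n. G k (v n k)) = (\<Sum>n\<le>M. \<Sum>k\<le>n. G k (v' n k))"
    by (intro sum.cong refl) (simp only: atMost_iff right_minus_eq)
  then show ?thesis
    unfolding ext[of G, OF G] .
qed

lemma kashiwara_f_eq:
  assumes "string_decomposition V E F K x N u"
  shows "kashiwara_f V E F K x = (\<Sum>n\<le>N. \<Sum>k\<le>n. divided_power F (k + 1) (u n k))"
  unfolding kashiwara_f_def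
proof (rule the_equality)
  fix y assume "\<exists>N u. string_decomposition V E F K x N u \<and>
    y = (\<Sum>n\<le>N. \<Sum>k\<le>n. divided_power F (k + 1) (u n k))"
  then obtain N' u' where "string_decomposition V E F K x N' u'"
    and y: "y = (\<Sum>n\<le>N'. \<Sum>k\<le>n. divided_power F (k + 1) (u' n k))" by blast
  then show "y = (\<Sum>n\<le>N. \<Sum>k\<le>n. divided_power F (k + 1) (u n k))"
    unfolding y by (intro string_decomposition_unique[OF _ assms] divided_power_0)
qed (use assms in blast)

lemma kashiwara_e_eq:
  assumes "string_decomposition V E F K x N u"
  shows "kashiwara_e V E F K x = (\<Sum>n\<le>N. \<Sum>k=1..n. divided_power F (k - 1) (u n k))"
  unfolding kashiwara_e_def
proof (rule the_equality)
  (* The zero map in degree 0 turns the sum over k = 1..n into one over k \<le> n. *)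
  define G where "G k y = (if k = 0 then 0 else divided_power F (k - 1) y)" for k y
  have G: "(\<Sum>k=1..n. divided_power F (k - 1) (u k)) = (\<Sum>k\<le>n. G k (u k))" for n and u :: "nat \<Rightarrow> qvec"
    by (rule sum.mono_neutral_cong_left) (auto simp: G_def)
  have G0: "G k 0 = 0" for k
    unfolding G_def using divided_power_0 by simp
  fix y assume "\<exists>N u. string_decomposition V E F K x N u \<and>
    y = (\<Sum>n\<le>N. \<Sum>k=1..n. divided_power F (k - 1) (u n k))"
  then obtain N' u' where "string_decomposition V E F K x N' u'"
    and y: "y = (\<Sum>n\<le>N'. \<Sum>k=1..n. divided_power F (k - 1) (u' n k))" by blast
  then show "y = (\<Sum>n\<le>N. \<Sum>k=1..n. divided_power F (k - 1) (u n k))"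
    unfolding y G by (intro string_decomposition_unique[OF _ assms] G0)
qed (use assms in blast)

lemma single_string_sum:
  fixes k0 n0 :: nat
  assumes "k0 \<le> n0" "\<And>k. G k 0 = (0 :: qvec)"
  shows "(\<Sum>n\<le>n0. \<Sum>k\<le>n. G k (if n = n0 \<and> k = k0 then u else 0)) = G k0 u"
proof -
  have "(\<Sum>k\<le>n. G k (if n = n0 \<and> k = k0 then u else 0)) = (if n = n0 then G k0 u else 0)" for n
  proof (cases "n = n0")
    case True
    have "G k (if k = k0 then u else 0) = (if k = k0 then G k u else 0)" for k
      using assms(2) by simp
    then show ?thesis
      using True assms(1) by simp
  next
    case False
    then show ?thesis
      using assms(2) by simp
  qed
  then show ?thesis by simp
qed

lemma string_decomposition_single:
  assumes "highest (int n0) u" "k0 \<le> n0"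
  shows "string_decomposition V E F K (divided_power F k0 u) n0 (\<lambda>n k. if n = n0 \<and> k = k0 then u else 0)"
  unfolding string_decomposition_def
proof (intro conjI)
  show "divided_power F k0 u = (\<Sum>n\<le>n0. \<Sum>k\<le>n. divided_power F k (if n = n0 \<and> k = k0 then u else 0))"
    by (rule single_string_sum[of k0 n0 "divided_power F" u, OF assms(2) divided_power_0, symmetric])
  have "highest (int n) (if n = n0 \<and> k = k0 then u else 0)" for n k
    using assms(1) highest_0 by simp
  then show "\<forall>n\<le>n0. \<forall>k\<le>n. (if n = n0 \<and> k = k0 then u else 0) \<in> V \<and>
      E (if n = n0 \<and> k = k0 then u else 0) = 0 \<and>
      K (if n = n0 \<and> k = k0 then u else 0) = scl (q powi int n) (if n = n0 \<and> k = k0 then u else 0)"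
    unfolding highest_def by blast
qed

lemma divided_power_0_1: "divided_power F 0 x = x" "divided_power F (Suc 0) x = F x"
  by (simp_all add: divided_power_def qfact_def qint_eq_qnum qnum_1)

lemma kashiwara_f_highest:
  assumes "highest (int n) u"
  shows "kashiwara_f V E F K u = F u"
  using kashiwara_f_eq[OF string_decomposition_single[OF assms, of 0]]
    single_string_sum[of 0 n "\<lambda>k. divided_power F (k + 1)" u] divided_power_0
  by (simp add: divided_power_0_1)

lemma kashiwara_e_F_highest:
  assumes "highest (int n) u" "n \<ge> 1"
  shows "kashiwara_e V E F K (F u) = u"
proof -
  (* The zero map in degree 0 turns the sum over k = 1..n into one over k \<le> n. *)
  define G where "G k y = (if k = 0 then 0 else divided_power F (k - 1) y)" for k y
  have G: "(\<Sum>k=1..n. divided_power F (k - 1) (u k)) = (\<Sum>k\<le>n. G k (u k))" for n and u :: "nat \<Rightarrow> qvec"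
    by (rule sum.mono_neutral_cong_left) (auto simp: G_def)
  have G0: "G k 0 = 0" for k
    unfolding G_def using divided_power_0 by simp
  have "kashiwara_e V E F K (divided_power F 1 u)
      = (\<Sum>m\<le>n. \<Sum>k\<le>m. G k (if m = n \<and> k = 1 then u else 0))"
    using kashiwara_e_eq[OF string_decomposition_single[OF assms]] unfolding G .
  also have "\<dots> = G 1 u"
    by (rule single_string_sum[of 1 n G u, OF assms(2) G0])
  finally show ?thesis
    by (simp add: G_def divided_power_0_1)
qed

end

section \<open>Weights of a crystal\<close>

text \<open>A module together with a crystal base, as it underlies a classical crystal.\<close>

locale crystal_module =
  fixes I :: "nat set" and D :: diagram and V :: "qvec set"
    and E F K K' :: "nat \<Rightarrow> qvec \<Rightarrow> qvec" and L :: "qvec set"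
    and B :: "'b set" and v :: "'b \<Rightarrow> qvec" and e f :: "nat \<Rightarrow> 'b \<Rightarrow> 'b option"
  assumes module: "Uq_module I D V E F K K'"
    and base: "crystal_base I V E F K L B v e f"
begin

lemma relations:
  assumes "i \<in> I" "j \<in> I" "x \<in> V"
  shows "K i (E j x) = scl (q powi cartan D i j) (E j (K i x))"
    "K i (F j x) = scl (q powi (- cartan D i j)) (F j (K i x))"
    "E i (F j x) - F j (E i x) = (if i = j then scl (1 / (q - inverse q)) (K i x - K' i x) else 0)"
proof -
  have "\<forall>i\<in>I. \<forall>j\<in>I. \<forall>x\<in>V.
        K i (K j x) = K j (K i x) \<and>
        K i (E j x) = scl (q powi cartan D i j) (E j (K i x)) \<and>
        K i (F j x) = scl (q powi (- cartan D i j)) (F j (K i x)) \<and>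
        E i (F j x) - F j (E i x) =
          (if i = j then scl (1 / (q - inverse q)) (K i x - K' i x) else 0)"
    using module unfolding Uq_module_def by (elim conjE)
  from bspec[OF bspec[OF bspec[OF this assms(1)] assms(2)] assms(3)]
  show "K i (E j x) = scl (q powi cartan D i j) (E j (K i x))"
    "K i (F j x) = scl (q powi (- cartan D i j)) (F j (K i x))"
    "E i (F j x) - F j (E i x) = (if i = j then scl (1 / (q - inverse q)) (K i x - K' i x) else 0)"
    by blast+
qed

lemma sl2:
  assumes "i \<in> I"
  shows "Uq_sl2 V (E i) (F i) (K i) (K' i)"
proof (rule Uq_sl2.intro)
  show "qvs.subspace V"
    using module qvs.subspace_span unfolding Uq_module_def by metis
  have lin: "\<forall>X\<in>{E i, F i, K i, K' i}. qlinear X \<and> X ` V \<subseteq> V"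
    using module assms unfolding Uq_module_def by blast
  then show "qlinear (E i)" "qlinear (F i)" "qlinear (K i)" "qlinear (K' i)" by blast+
  show "E i x \<in> V" "F i x \<in> V" "K' i x \<in> V" if "x \<in> V" for x
    using lin that by blast+
  show "K i (K' i x) = x" "K' i (K i x) = x" if "x \<in> V" for x
    using module assms that unfolding Uq_module_def by blast+
  have "cartan D i i = 2" by (simp add: cartan_def)
  then show "K i (E i x) = scl (q powi 2) (E i (K i x))" "K i (F i x) = scl (q powi (-2)) (F i (K i x))"
    "E i (F i x) - F i (E i x) = scl (1 / (q - inverse q)) (K i x - K' i x)" if "x \<in> V" for x
    using relations[OF assms assms that] by simp_all
qed

lemma K_E_F:
  assumes "i \<in> I" "j \<in> I" "x \<in> V" "K i x = scl (q powi n) x"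
  shows "K i (E j x) = scl (q powi (n + cartan D i j)) (E j x)"
    and "K i (F j x) = scl (q powi (n - cartan D i j)) (F j x)"
proof -
show "K i (E j x) = scl (q powi (n + cartan D i j)) (E j x)"
    "K i (F j x) = scl (q powi (n - cartan D i j)) (F j x)"
    unfolding relations[OF assms(1-3)] assms(4) qlinear_scale[OF Uq_sl2.lin_E[OF sl2[OF assms(2)]]]
      qlinear_scale[OF Uq_sl2.lin_F[OF sl2[OF assms(2)]]] qvs.scale_scale q_powi_add[symmetric]
    by (simp_all only: add.commute diff_conv_add_uminus)
qed

lemma lattice: "crystal_lattice I V E F K L"
  using base unfolding crystal_base_def by blast

lemma finite_B: "finite B"
  using base unfolding crystal_base_def by blast

lemma spanning: "x \<in> L \<Longrightarrow> \<exists>c :: 'b \<Rightarrow> rat. x - (\<Sum>b\<in>B. scl (of_rat (c b)) (v b)) \<in> scl q ` L"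
  using base unfolding crystal_base_def by (elim conjE) (erule (1) bspec)

lemma v_weight_vector: "b \<in> B \<Longrightarrow> v b \<in> L \<inter> weight_vectors I K"
  using base unfolding crystal_base_def by (elim conjE) (erule (1) bspec)

lemma lattice_graded: "\<forall>x\<in>L. \<exists>W. finite W \<and> W \<subseteq> L \<inter> weight_vectors I K \<and> x = \<Sum>W"
  using lattice unfolding crystal_lattice_def weight_graded_def by (elim conjE)

lemma lattice_basis:
  obtains S where "finite S" "qvs.independent S" "qvs.span S = V"
    "L = {\<Sum>s\<in>S. scl (a s) s | a. a ` S \<subseteq> regular_at_0}"
  using lattice unfolding crystal_lattice_def by blast

lemma lattice_subset: "L \<subseteq> V"
proof -
  obtain S where S: "qvs.span S = V" "L = {\<Sum>s\<in>S. scl (a s) s | a. a ` S \<subseteq> regular_at_0}"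
    by (rule lattice_basis)
  have "(\<Sum>s\<in>S. scl (a s) s) \<in> V" for a
    unfolding S(1)[symmetric] by (intro qvs.span_sum qvs.span_scale qvs.span_base)
  then show ?thesis unfolding S(2) by blast
qed

lemma lattice_add:
  assumes "x \<in> L" "y \<in> L"
  shows "x + y \<in> L"
proof -
  obtain S where L: "L = {\<Sum>s\<in>S. scl (a s) s | a. a ` S \<subseteq> regular_at_0}"
    by (rule lattice_basis)
  obtain a b where "x = (\<Sum>s\<in>S. scl (a s) s)" "a ` S \<subseteq> regular_at_0"
    "y = (\<Sum>s\<in>S. scl (b s) s)" "b ` S \<subseteq> regular_at_0"
    using assms unfolding L by blast
  moreover from this have "x + y = (\<Sum>s\<in>S. scl (a s + b s) s)"
    by (simp only: qvs.scale_left_distrib sum.distrib)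
  moreover have "(\<lambda>s. a s + b s) ` S \<subseteq> regular_at_0"
    using calculation(2,4) regular_add by (auto simp: image_subset_iff)
  ultimately show ?thesis
    unfolding L mem_Collect_eq by (intro exI[of _ "\<lambda>s. a s + b s"] conjI)
qed

lemma lattice_scale:
  assumes "c \<in> regular_at_0" "x \<in> L"
  shows "scl c x \<in> L"
proof -
  obtain S where L: "L = {\<Sum>s\<in>S. scl (a s) s | a. a ` S \<subseteq> regular_at_0}"
    by (rule lattice_basis)
  obtain a where "x = (\<Sum>s\<in>S. scl (a s) s)" "a ` S \<subseteq> regular_at_0"
    using assms unfolding L by blast
  moreover from this have "scl c x = (\<Sum>s\<in>S. scl (c * a s) s)"
    by (simp only: qvs.scale_sum_right qvs.scale_scale)
  moreover have "(\<lambda>s. c * a s) ` S \<subseteq> regular_at_0"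
    using calculation(2) regular_mult[OF assms(1)] by (auto simp: image_subset_iff)
  ultimately show ?thesis
    unfolding L mem_Collect_eq by (intro exI[of _ "\<lambda>s. c * a s"] conjI)
qed

lemma v_not_in_qL:
  assumes "b \<in> B"
  shows "v b \<notin> scl q ` L"
proof
  define c :: "'b \<Rightarrow> rat" where "c b' = (if b' = b then 1 else 0)" for b'
  have "(\<Sum>b'\<in>B. scl (of_rat (c b')) (v b')) = (\<Sum>b'\<in>B. if b' = b then v b' else 0)"
    by (rule sum.cong) (simp_all add: c_def)
  also have "\<dots> = v b"
    using finite_B assms by simp
  finally have sum: "(\<Sum>b'\<in>B. scl (of_rat (c b')) (v b')) = v b" .
  have "\<forall>c :: 'b \<Rightarrow> rat. (\<Sum>b\<in>B. scl (of_rat (c b)) (v b)) \<in> scl q ` L \<longrightarrow> (\<forall>b\<in>B. c b = 0)"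
    using base unfolding crystal_base_def by (elim conjE)
  moreover assume "v b \<in> scl q ` L"
  ultimately have "c b = 0"
    using sum assms by metis
  then show False by (simp add: c_def)
qed

lemma zero_in_L: "0 \<in> L"
proof -
  obtain S where L: "L = {\<Sum>s\<in>S. scl (a s) s | a. a ` S \<subseteq> regular_at_0}"
    by (rule lattice_basis)
  have "0 = (\<Sum>s\<in>S. scl 0 s)" by simp
  moreover have "(\<lambda>_. 0) ` S \<subseteq> regular_at_0" using zero_regular by blast
  ultimately show ?thesis
    unfolding L mem_Collect_eq by (intro exI[of _ "\<lambda>_. 0"] conjI)
qed

lemma lattice_sum: "(\<And>a. a \<in> A \<Longrightarrow> y a \<in> L) \<Longrightarrow> sum y A \<in> L"
  by (induction A rule: infinite_finite_induct) (auto intro: zero_in_L lattice_add)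

lemma qL_diff:
  assumes "x \<in> scl q ` L" "y \<in> scl q ` L"
  shows "x - y \<in> scl q ` L"
proof -
  obtain x' y' where "x = scl q x'" "x' \<in> L" "y = scl q y'" "y' \<in> L" using assms by blast
  moreover from this have "x - y = scl q (x' + scl (-1) y')"
    by (simp add: qvs.scale_right_diff_distrib)
  moreover have "x' + scl (-1) y' \<in> L"
    using calculation by (intro lattice_add lattice_scale minus_1_regular)
  ultimately show ?thesis by blast
qed

text \<open>Divide by a dominant coefficient with respect to a basis of the lattice: all coefficients
  become regular and one of them becomes \<open>1\<close>.\<close>

lemma primitive_multiple:
  assumes "x \<in> V" "x \<noteq> 0"
  obtains c where "c \<noteq> 0" "scl c x \<in> L" "scl c x \<notin> scl q ` L"
proof -
  obtain S where S: "finite S" "qvs.independent S" "qvs.span S = V"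
    and L: "L = {\<Sum>s\<in>S. scl (a s) s | a. a ` S \<subseteq> regular_at_0}"
    by (rule lattice_basis)
  obtain a where a: "x = (\<Sum>s\<in>S. scl (a s) s)"
    using assms(1) unfolding S(3)[symmetric] qvs.span_finite[OF S(1)] by blast
  have "\<exists>s\<in>S. a s \<noteq> 0"
  proof (rule ccontr)
    assume "\<not> ?thesis"
    then have "x = 0" unfolding a by (intro sum.neutral) simp
    with assms(2) show False by blast
  qed
  from dominant_coefficient[OF S(1) this] obtain t where t: "t \<in> S" "a t \<noteq> 0"
    and reg: "\<forall>s\<in>S. a s / a t \<in> regular_at_0" by blast
  have x: "scl (inverse (a t)) x = (\<Sum>s\<in>S. scl (a s / a t) s)"
    unfolding a by (simp only: qvs.scale_sum_right qvs.scale_scale divide_inverse mult.commute)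
  show thesis
  proof (rule that)
    show "inverse (a t) \<noteq> 0" using t(2) by simp
    show "scl (inverse (a t)) x \<in> L"
      unfolding x L mem_Collect_eq using reg by (intro exI[of _ "\<lambda>s. a s / a t"] conjI) auto
    show "scl (inverse (a t)) x \<notin> scl q ` L"
    proof
      assume "scl (inverse (a t)) x \<in> scl q ` L"
      then obtain c where c: "scl (inverse (a t)) x = scl q (\<Sum>s\<in>S. scl (c s) s)" "c ` S \<subseteq> regular_at_0"
        unfolding L by blast
      then have "(\<Sum>s\<in>S. scl (a s / a t) s) - (\<Sum>s\<in>S. scl (q * c s) s) = 0"
        unfolding x by (simp only: qvs.scale_sum_right qvs.scale_scale diff_self)
      then have "(\<Sum>s\<in>S. scl (a s / a t - q * c s) s) = 0"
        by (simp only: qvs.scale_left_diff_distrib sum_subtractf)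
      then have "a t / a t - q * c t = 0"
        using qvs.independentD[OF S(2) S(1) subset_refl, of "\<lambda>s. a s / a t - q * c s" t] t(1) by blast
      then have "q * c t = 1" using t(2) by simp
      then have "inverse q = c t" by (rule inverse_unique)
      with c(2) t(1) inverse_q_not_regular show False by auto
    qed
  qed
qed

text \<open>The lattice is weight graded, so a congruence modulo \<open>q L\<close> may be compared weight by weight.
  Since \<open>x\<close> has weight \<open>n\<close>, only the summands of that weight matter.\<close>

lemma weight_component:
  assumes "i \<in> I" "finite A" and y: "\<forall>b\<in>A. K i (y b) = scl (q powi m b) (y b)"
    and x: "K i x = scl (q powi n) x" and cong: "x - (\<Sum>b\<in>A. y b) \<in> scl q ` L"
  shows "x - (\<Sum>b\<in>{b\<in>A. m b = n}. y b) \<in> scl q ` L"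
proof -
  obtain z where z: "z \<in> L" "x - (\<Sum>b\<in>A. y b) = scl q z" using cong by blast
  obtain W where W: "finite W" "W \<subseteq> L" "W \<subseteq> weight_vectors I K" "z = \<Sum>W"
    using bspec[OF lattice_graded z(1)] by blast
  have "\<forall>w\<in>W. \<exists>n. K i w = scl (q powi n) w"
    using W(3) assms(1) unfolding weight_vectors_def by blast
  then obtain \<mu> where \<mu>: "\<forall>w\<in>W. K i w = scl (q powi \<mu> w) w" by metis
  define M where "M = insert n (m ` A \<union> \<mu> ` W)"
  (* The part of weight l of x - sum y A - q z, which is zero in total. *)
  define t where "t l = (if l = n then x else 0) - (\<Sum>b\<in>{b\<in>A. m b = l}. y b)
      - scl q (\<Sum>w\<in>{w\<in>W. \<mu> w = l}. w)" for l
  note lin = Uq_sl2.lin_K[OF sl2[OF assms(1)]]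
  have "finite M" unfolding M_def using assms(2) W(1) by simp
  have "K i (t l) = scl (q powi l) (t l)" for l
  proof -
    have "K i (if l = n then x else 0) = scl (q powi l) (if l = n then x else 0)"
      using x qlinear_zero[OF lin] by simp
    moreover have "K i (\<Sum>b\<in>{b\<in>A. m b = l}. y b) = scl (q powi l) (\<Sum>b\<in>{b\<in>A. m b = l}. y b)"
      unfolding qlinear_sum[OF lin] qvs.scale_sum_right using y by (intro sum.cong) auto
    moreover have "K i (\<Sum>w\<in>{w\<in>W. \<mu> w = l}. w) = scl (q powi l) (\<Sum>w\<in>{w\<in>W. \<mu> w = l}. w)"
      unfolding qlinear_sum[OF lin] qvs.scale_sum_right using \<mu> by (intro sum.cong) auto
    ultimately show ?thesis
      unfolding t_def qlinear_diff[OF lin] qlinear_scale[OF lin] qvs.scale_right_diff_distrib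
      by (simp only: qvs.scale_scale mult.commute)
  qed
  moreover have "(\<Sum>l\<in>M. t l) = 0"
  proof -
    have "(\<Sum>l\<in>M. t l) = (\<Sum>l\<in>M. if l = n then x else 0) - (\<Sum>l\<in>M. \<Sum>b\<in>{b\<in>A. m b = l}. y b)
      - scl q (\<Sum>l\<in>M. \<Sum>w\<in>{w\<in>W. \<mu> w = l}. w)"
      unfolding t_def by (simp only: sum_subtractf qvs.scale_sum_right)
    also have "(\<Sum>l\<in>M. if l = n then x else 0) = x"
      using \<open>finite M\<close> by (simp add: M_def)
    also have "(\<Sum>l\<in>M. \<Sum>b\<in>{b\<in>A. m b = l}. y b) = (\<Sum>b\<in>A. y b)"
      by (rule sum.group) (use \<open>finite M\<close> assms(2) in \<open>auto simp: M_def\<close>)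
    also have "(\<Sum>l\<in>M. \<Sum>w\<in>{w\<in>W. \<mu> w = l}. w) = z"
      unfolding W(4) by (rule sum.group) (use \<open>finite M\<close> W(1) in \<open>auto simp: M_def\<close>)
    finally show ?thesis unfolding z(2) by simp
  qed
  ultimately have "t n = 0"
    using eigenvectors_independent[OF lin \<open>finite M\<close>, of t] unfolding M_def by blast
  then have "x - (\<Sum>b\<in>{b\<in>A. m b = n}. y b) = scl q (\<Sum>w\<in>{w\<in>W. \<mu> w = n}. w)"
    unfolding t_def by simp
  moreover have "(\<Sum>w\<in>{w\<in>W. \<mu> w = n}. w) \<in> L"
    by (rule lattice_sum) (use W(2) in auto)
  ultimately show ?thesis by blast
qed

definition wt :: "'b \<Rightarrow> nat \<Rightarrow> int" where
  "wt b = (SOME w. \<forall>i\<in>I. K i (v b) = scl (q powi w i) (v b))"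

lemma K_v:
  assumes "b \<in> B" "i \<in> I"
  shows "K i (v b) = scl (q powi wt b i) (v b)"
proof -
  have "\<exists>w. \<forall>i\<in>I. K i (v b) = scl (q powi w i) (v b)"
    using v_weight_vector[OF assms(1)] unfolding weight_vectors_def by blast
  then have "\<forall>i\<in>I. K i (v b) = scl (q powi wt b i) (v b)"
    unfolding wt_def by (rule someI_ex)
  with assms(2) show ?thesis by blast
qed

text \<open>Scale \<open>x\<close> to an element of \<open>L\<close> outside \<open>q L\<close> and expand it modulo \<open>q L\<close> in the crystal base.
  Only basis elements of the weight of \<open>x\<close> contribute, so there is one. Two nodes are needed to
  control the weights at both of them; taking \<open>i = j\<close> gives the version for a single node.\<close>

lemma weight_of_basis_element:
  assumes "i \<in> I" "j \<in> I" "x \<in> V" "x \<noteq> 0"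
    "K i x = scl (q powi m) x" "K j x = scl (q powi n) x"
  shows "\<exists>b\<in>B. wt b i = m \<and> wt b j = n"
proof (rule ccontr)
  assume none: "\<not> ?thesis"
  obtain c where c: "scl c x \<in> L" "scl c x \<notin> scl q ` L"
    using primitive_multiple[OF assms(3,4)] by metis
  obtain r :: "'b \<Rightarrow> rat" where "scl c x - (\<Sum>b\<in>B. scl (of_rat (r b)) (v b)) \<in> scl q ` L"
    using spanning[OF c(1)] by blast
  note coeffs = this
  have K: "K k (scl (of_rat (r b)) (v b)) = scl (q powi wt b k) (scl (of_rat (r b)) (v b))"
    if "b \<in> B" "k \<in> I" for b k
    unfolding qlinear_scale[OF Uq_sl2.lin_K[OF sl2[OF that(2)]]] K_v[OF that] qvs.scale_scale
    by (simp only: mult.commute)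
  have Kx: "K i (scl c x) = scl (q powi m) (scl c x)" "K j (scl c x) = scl (q powi n) (scl c x)"
    unfolding qlinear_scale[OF Uq_sl2.lin_K[OF sl2[OF assms(1)]]]
      qlinear_scale[OF Uq_sl2.lin_K[OF sl2[OF assms(2)]]] assms(5,6) qvs.scale_scale
    by (simp_all only: mult.commute)
  have Ki: "\<forall>b\<in>B. K i (scl (of_rat (r b)) (v b)) = scl (q powi wt b i) (scl (of_rat (r b)) (v b))"
    and Kj: "\<forall>b\<in>{b\<in>B. wt b i = m}. K j (scl (of_rat (r b)) (v b)) = scl (q powi wt b j) (scl (of_rat (r b)) (v b))"
    using K assms(1,2) by (metis, metis mem_Collect_eq)
  have fin: "finite {b\<in>B. wt b i = m}" using finite_B by simp
  note weight_component[OF assms(1) finite_B Ki Kx(1) coeffs]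
  note weight_component[OF assms(2) fin Kj Kx(2) this]
  also have "{b\<in>{b\<in>B. wt b i = m}. wt b j = n} = {}" using none by blast
  finally show False using c(2) by simp
qed


section \<open>Equal crystal operators at orthogonal nodes\<close>

lemma lattice_closed:
  assumes "i \<in> I" "x \<in> L"
  shows "kashiwara_e V (E i) (F i) (K i) x \<in> L"
proof -
  have "\<forall>i\<in>I. \<forall>x\<in>L. kashiwara_e V (E i) (F i) (K i) x \<in> L \<and> kashiwara_f V (E i) (F i) (K i) x \<in> L"
    using lattice unfolding crystal_lattice_def by (elim conjE)
  from bspec[OF bspec[OF this assms(1)] assms(2)] show ?thesis by (rule conjunct1)
qed

lemma crystal_f:
  assumes "i \<in> I" "b \<in> B"
  shows "f i b = None \<Longrightarrow> kashiwara_f V (E i) (F i) (K i) (v b) \<in> scl q ` L"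
    and "f i b = Some b' \<Longrightarrow> kashiwara_f V (E i) (F i) (K i) (v b) - v b' \<in> scl q ` L"
    and "f i b = Some b' \<Longrightarrow> b' \<in> B"
proof -
  have "\<forall>i\<in>I. \<forall>b\<in>B.
        (case e i b of
           None \<Rightarrow> kashiwara_e V (E i) (F i) (K i) (v b) \<in> scl q ` L
         | Some b' \<Rightarrow> b' \<in> B \<and> kashiwara_e V (E i) (F i) (K i) (v b) - v b' \<in> scl q ` L) \<and>
        (case f i b of
           None \<Rightarrow> kashiwara_f V (E i) (F i) (K i) (v b) \<in> scl q ` L
         | Some b' \<Rightarrow> b' \<in> B \<and> kashiwara_f V (E i) (F i) (K i) (v b) - v b' \<in> scl q ` L)"
    using base unfolding crystal_base_def by (elim conjE)
  from conjunct2[OF bspec[OF bspec[OF this assms(1)] assms(2)]]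
  show "f i b = None \<Longrightarrow> kashiwara_f V (E i) (F i) (K i) (v b) \<in> scl q ` L"
    "f i b = Some b' \<Longrightarrow> kashiwara_f V (E i) (F i) (K i) (v b) - v b' \<in> scl q ` L"
    "f i b = Some b' \<Longrightarrow> b' \<in> B"
    by simp_all
qed

lemma v_nonzero: "b \<in> B \<Longrightarrow> v b \<noteq> 0"
  using v_not_in_qL zero_in_L qvs.scale_zero_right by (metis imageI)

lemma v_in_V: "b \<in> B \<Longrightarrow> v b \<in> V"
  using v_weight_vector lattice_subset by blast

text \<open>Otherwise no \<open>F\<^sup>j u\<close> would vanish, and their weights are infinitely many.\<close>

lemma highest_weight_nonneg:
  assumes "i \<in> I" "Uq_sl2.highest V (E i) (K i) n u" "u \<noteq> 0"
  shows "n \<ge> 0"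
proof (rule ccontr)
  interpret s: Uq_sl2 V "E i" "F i" "K i" "K' i" by (rule sl2[OF assms(1)])
  have u: "u \<in> V" "K i u = scl (q powi n) u" using assms(2) unfolding s.highest_def by blast+
  assume "\<not> n \<ge> 0"
  then have neg: "n < 0" by simp
  have "n - 2 * int j \<in> (\<lambda>b. wt b i) ` B" for j
  proof -
    have "(F i ^^ j) u \<noteq> 0"
      by (rule s.F_power_nonzero[OF assms(2,3)]) (use neg in auto)
    from weight_of_basis_element[OF assms(1,1) s.F_power_closed[OF u(1)] this s.K_F_power[OF u] s.K_F_power[OF u]]
    have "\<exists>b\<in>B. wt b i = n - 2 * int j" by blast
    then show ?thesis by force
  qed
  then have "finite (range (\<lambda>j. n - 2 * int j))"
    using finite_B by (meson finite_imageI finite_subset image_subsetI)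
  moreover have "inj (\<lambda>j. n - 2 * int j)" by (rule injI) simp
  ultimately show False using finite_imageD by blast
qed

text \<open>Kashiwara's \<open>e\<close> maps \<open>F u\<close> back to \<open>u\<close> and preserves \<open>q L\<close>.\<close>

lemma F_highest_not_in_qL:
  assumes "i \<in> I" "Uq_sl2.highest V (E i) (K i) (int n) u" "n \<ge> 1" "u \<in> L" "u \<notin> scl q ` L"
  shows "F i u \<notin> scl q ` L"
proof
  interpret s: Uq_sl2 V "E i" "F i" "K i" "K' i" by (rule sl2[OF assms(1)])
  assume "F i u \<in> scl q ` L"
  then obtain z where z: "F i u = scl q z" "z \<in> L" by (elim imageE)
  have "F i (scl (inverse q) u) = scl (inverse q) (scl q z)"
    unfolding qlinear_scale[OF s.lin_F] z(1) ..
  also have "\<dots> = z" by simp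
  finally have "kashiwara_e V (E i) (F i) (K i) z = scl (inverse q) u"
    using s.kashiwara_e_F_highest[OF s.highest_scale[OF assms(2)] assms(3), of "inverse q"] by simp
  then have "scl (inverse q) u \<in> L"
    using lattice_closed[OF assms(1) z(2)] by simp
  moreover have "u = scl q (scl (inverse q) u)" by simp
  ultimately show False using assms(5) by (metis imageI)
qed

text \<open>A basis vector of minimal weight \<open>m < 0\<close> is a lowest weight vector, and applying \<open>E\<close> to it \<open>-m\<close>
  times gives a nonzero vector of weight \<open>-m\<close>.\<close>

lemma positive_weight_exists:
  assumes "i \<in> I" "b0 \<in> B" "wt b0 i \<noteq> 0"
  shows "\<exists>b\<in>B. wt b i > 0"
proof (cases "wt b0 i > 0")
  case False
  interpret s: Uq_sl2 V "F i" "E i" "K' i" "K i"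
    by (rule Uq_sl2.swap_sl2[OF sl2[OF assms(1)]])
  interpret t: Uq_sl2 V "E i" "F i" "K i" "K' i" by (rule sl2[OF assms(1)])
  define m where "m = Min ((\<lambda>b. wt b i) ` B)"
  have "m \<in> (\<lambda>b. wt b i) ` B"
    unfolding m_def using finite_B assms(2) by (intro Min_in) auto
  then obtain b where b: "b \<in> B" "wt b i = m" by (metis imageE)
  have min: "m \<le> wt b' i" if "b' \<in> B" for b'
    unfolding m_def using finite_B that by (intro Min_le) auto
  have "m < 0" using min[OF assms(2)] False assms(3) by simp
  have Kb: "K i (v b) = scl (q powi m) (v b)"
    using K_v[OF b(1) assms(1)] b(2) by simp
  have "F i (v b) = 0"
  proof (rule ccontr)
    assume "F i (v b) \<noteq> 0"
    moreover have "K i (F i (v b)) = scl (q powi (m - cartan D i i)) (F i (v b))"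
      by (rule K_E_F(2)[OF assms(1,1) v_in_V[OF b(1)] Kb])
    ultimately obtain b' where "b' \<in> B" "wt b' i = m - cartan D i i"
      using weight_of_basis_element[OF assms(1,1) t.F_closed[OF v_in_V[OF b(1)]]] by blast
    moreover have "cartan D i i = 2" by (simp add: cartan_def)
    ultimately show False using min[of b'] by simp
  qed
  then have hw: "s.highest (- m) (v b)"
    using t.K'_weight[OF v_in_V[OF b(1)] Kb] v_in_V[OF b(1)] unfolding s.highest_def by blast
  define x where "x = (E i ^^ nat (- m)) (v b)"
  have "x \<noteq> 0"
    unfolding x_def by (rule s.F_power_nonzero[OF hw v_nonzero[OF b(1)]]) auto
  moreover have xV: "x \<in> V"
    unfolding x_def by (rule s.F_power_closed[OF v_in_V[OF b(1)]])
  moreover have "K' i x = scl (q powi (- m - 2 * int (nat (- m)))) x"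
    unfolding x_def using s.K_F_power[OF v_in_V[OF b(1)]] hw unfolding s.highest_def by blast
  then have "K' i x = scl (q powi m) x"
    using \<open>m < 0\<close> by simp
  from s.K'_weight[OF xV this] have "K i x = scl (q powi (- m)) x" .
  ultimately obtain b' where "b' \<in> B" "wt b' i = - m"
    using weight_of_basis_element[OF assms(1,1)] by blast
  with \<open>m < 0\<close> show ?thesis by force
qed (use assms in blast)

text \<open>For orthogonal nodes, \<open>F\<^sub>i\<close> preserves the weight at \<open>j\<close> while \<open>F\<^sub>j\<close> lowers it by \<open>2\<close>. A basis
  vector that is extremal for both nodes exhibits the difference, because Kashiwara's operators act
  on it as \<open>F\<^sub>i\<close> and \<open>F\<^sub>j\<close>.\<close>

lemma equal_operators_weight_0:
  assumes ij: "i \<in> I" "j \<in> I" "i \<noteq> j" "{i, j} \<notin> D"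
    and same: "\<forall>b\<in>B. f i b = f j b"
    and "b0 \<in> B"
  shows "wt b0 i = 0"
proof (rule ccontr)
  interpret si: Uq_sl2 V "E i" "F i" "K i" "K' i" by (rule sl2[OF ij(1)])
  interpret sj: Uq_sl2 V "E j" "F j" "K j" "K' j" by (rule sl2[OF ij(2)])
  have cartan: "cartan D i i = 2" "cartan D j j = 2" "cartan D i j = 0" "cartan D j i = 0"
    using ij(3,4) by (auto simp: cartan_def insert_commute)
  assume "wt b0 i \<noteq> 0"
  then obtain b1 where b1: "b1 \<in> B" "wt b1 i > 0"
    using positive_weight_exists[OF ij(1) \<open>b0 \<in> B\<close>] by blast
  define n where "n = Max ((\<lambda>b. wt b i) ` B)"
  have max: "wt b i \<le> n" if "b \<in> B" for b
    unfolding n_def using finite_B that by (intro Max_ge) auto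
  have "n \<in> (\<lambda>b. wt b i) ` B"
    unfolding n_def using finite_B b1(1) by (intro Max_in) auto
  then have ne: "{b\<in>B. wt b i = n} \<noteq> {}" by auto
  (* Maximising at i first makes E i kill u; E j preserves the weight at i, so maximality at j
     among the vectors of weight n at i makes it kill u as well. *)
  define m where "m = Max ((\<lambda>b. wt b j) ` {b\<in>B. wt b i = n})"
  have fin: "finite ((\<lambda>b. wt b j) ` {b\<in>B. wt b i = n})" using finite_B by simp
  have "m \<in> (\<lambda>b. wt b j) ` {b\<in>B. wt b i = n}"
    unfolding m_def using fin ne by (intro Max_in) auto
  then obtain b where b: "b \<in> B" "wt b i = n" "wt b j = m" by blast
  have maxj: "wt b' j \<le> m" if "b' \<in> B" "wt b' i = n" for b'
    unfolding m_def using that by (intro Max_ge[OF fin]) auto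
  define u where "u = v b"
  have u: "u \<in> V" "u \<noteq> 0" "u \<in> L" "u \<notin> scl q ` L"
    unfolding u_def using b(1) v_in_V v_nonzero v_weight_vector v_not_in_qL by blast+
  have K: "K i u = scl (q powi n) u" "K j u = scl (q powi m) u"
    unfolding u_def using K_v[OF b(1)] ij(1,2) b(2,3) by auto
  have "E i u = 0"
  proof (rule ccontr)
    assume "E i u \<noteq> 0"
    then obtain b' where "b' \<in> B" "wt b' i = n + cartan D i i"
      using weight_of_basis_element[OF ij(1,1) si.E_closed[OF u(1)]] K_E_F(1)[OF ij(1,1) u(1) K(1)] by blast
    then show False using max[of b'] cartan by simp
  qed
  then have hi: "si.highest n u" unfolding si.highest_def using u(1) K(1) by blast
  have "E j u = 0"
  proof (rule ccontr)
    assume "E j u \<noteq> 0"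
    then obtain b' where "b' \<in> B" "wt b' i = n + cartan D i j" "wt b' j = m + cartan D j j"
      using weight_of_basis_element[OF ij(1,2) sj.E_closed[OF u(1)]]
        K_E_F(1)[OF ij(1,2) u(1) K(1)] K_E_F(1)[OF ij(2,2) u(1) K(2)] by blast
    then show False using maxj[of b'] cartan by simp
  qed
  then have hj: "sj.highest m u" unfolding sj.highest_def using u(1) K(2) by blast
  have "n \<ge> 1" using max[OF b1(1)] b1(2) by simp
  then have hi': "si.highest (int (nat n)) u" "nat n \<ge> 1" using hi by auto
  have "m \<ge> 0" by (rule highest_weight_nonneg[OF ij(2) hj u(2)])
  then have hj': "sj.highest (int (nat m)) u" using hj by simp
  have Fi: "F i u \<notin> scl q ` L"
    by (rule F_highest_not_in_qL[OF ij(1) hi' u(3,4)])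
  have kash: "kashiwara_f V (E i) (F i) (K i) (v b) = F i u" "kashiwara_f V (E j) (F j) (K j) (v b) = F j u"
    using si.kashiwara_f_highest[OF hi'(1)] sj.kashiwara_f_highest[OF hj'] unfolding u_def by blast+
  obtain b' where b': "f i b = Some b'"
    using crystal_f(1)[OF ij(1) b(1)] Fi unfolding kash by (metis option.exhaust)
  then have "f j b = Some b'" using same b(1) by simp
  then have "F i u - v b' \<in> scl q ` L" "F j u - v b' \<in> scl q ` L"
    using crystal_f(2)[OF ij(1) b(1) b'] crystal_f(2)[OF ij(2) b(1), of b'] unfolding kash by blast+
  then have "(F i u - v b') - (F j u - v b') \<in> scl q ` L"
    by (rule qL_diff)
  (* A one-element index set brings the congruence into the form of weight_component. *)
  then have "F i u - (\<Sum>_\<in>{()}. F j u) \<in> scl q ` L" by simp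
  moreover have "\<forall>_\<in>{()}. K j (F j u) = scl (q powi (m - cartan D j j)) (F j u)"
    using K_E_F(2)[OF ij(2,2) u(1) K(2)] by blast
  moreover have "K j (F i u) = scl (q powi m) (F i u)"
    using K_E_F(2)[OF ij(2,1) u(1) K(2)] cartan by simp
  ultimately have "F i u - (\<Sum>_\<in>{x\<in>{()}. m - cartan D j j = m}. F j u) \<in> scl q ` L"
    by (intro weight_component[OF ij(2)]) auto
  then have "F i u \<in> scl q ` L" using cartan by simp
  with Fi show False by blast
qed

lemma module_graded: "\<forall>x\<in>V. \<exists>W. finite W \<and> W \<subseteq> V \<inter> weight_vectors I K \<and> x = \<Sum>W"
  using module unfolding Uq_module_def weight_graded_def by (elim conjE)

lemma K_id_by_weight_vectors:
  assumes "i \<in> I" "\<And>n x. \<lbrakk>x \<in> V; x \<noteq> 0; K i x = scl (q powi n) x\<rbrakk> \<Longrightarrow> n = 0"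
    and "x \<in> V"
  shows "K i x = x"
proof -
  obtain W where W: "finite W" "W \<subseteq> V \<inter> weight_vectors I K" "x = \<Sum>W"
    using bspec[OF module_graded assms(3)] by blast
  note lin = Uq_sl2.lin_K[OF sl2[OF assms(1)]]
  have "K i w = w" if w: "w \<in> W" for w
  proof (cases "w = 0")
    case True
    then show ?thesis using qlinear_zero[OF lin] by simp
  next
    case False
    obtain n where n: "K i w = scl (q powi n) w"
      using subsetD[OF W(2) w] assms(1) unfolding weight_vectors_def by blast
    have "n = 0" using assms(2)[OF _ False n] W(2) w by blast
    with n show ?thesis by simp
  qed
  then show ?thesis
    unfolding W(3) qlinear_sum[OF lin] by simp
qed

text \<open>A vector in the image of \<open>E\<^sub>j\<close> or \<open>F\<^sub>j\<close> is multiplied by \<open>K\<^sub>i\<close> with a power of \<open>q\<close> different from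
  \<open>1\<close> and is also fixed by it. So \<open>E\<^sub>j\<close> and \<open>F\<^sub>j\<close> vanish, and with their commutator the weights at
  \<open>j\<close>.\<close>

lemma K_id_step:
  assumes "i \<in> I" "j \<in> I" "cartan D i j \<noteq> 0" and K: "\<forall>x\<in>V. K i x = x"
  shows "\<forall>x\<in>V. E j x = 0" "\<forall>x\<in>V. F j x = 0" "\<forall>x\<in>V. K j x = x"
proof -
  interpret sj: Uq_sl2 V "E j" "F j" "K j" "K' j" by (rule sl2[OF assms(2)])
  have fixed: "y = 0" if "y = scl (q powi n) y" "n \<noteq> 0" for y n
  proof -
    have "scl (q powi n - 1) y = 0"
      unfolding qvs.scale_left_diff_distrib using that(1) by simp
    moreover have "q powi n - 1 \<noteq> 0" using that(2) by simp
    ultimately show ?thesis unfolding qvs.scale_eq_0_iff by blast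
  qed
  have E: "E j y = 0" if "y \<in> V" for y
    using relations(1)[OF assms(1,2) that] bspec[OF K that] bspec[OF K sj.E_closed[OF that]] assms(3)
    by (intro fixed[of "E j y" "cartan D i j"]) auto
  have F: "F j y = 0" if "y \<in> V" for y
    using relations(2)[OF assms(1,2) that] bspec[OF K that] bspec[OF K sj.F_closed[OF that]] assms(3)
    by (intro fixed[of "F j y" "- cartan D i j"]) auto
  show "\<forall>x\<in>V. E j x = 0" "\<forall>x\<in>V. F j x = 0" using E F by blast+
  show "\<forall>x\<in>V. K j x = x"
  proof (intro ballI K_id_by_weight_vectors[OF assms(2)])
    fix n y assume y: "y \<in> V" "y \<noteq> 0" "K j y = scl (q powi n) y"
    have "E j (F j y) = F j (E j y) + scl (qnum n) y"
      by (rule sj.E_F_weight[OF y(1,3)])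
    then have "scl (qnum n) y = 0"
      using E[OF y(1)] E[OF sj.F_closed[OF y(1)]] qlinear_zero[OF sj.lin_F] by simp
    with y(2) show "n = 0" unfolding qvs.scale_eq_0_iff by simp
  qed
qed

lemma f_None_if_K_id:
  assumes "i \<in> I" "b \<in> B" "\<forall>x\<in>V. K i x = x"
  shows "f i b = None"
proof (rule ccontr)
  interpret s: Uq_sl2 V "E i" "F i" "K i" "K' i" by (rule sl2[OF assms(1)])
  have "cartan D i i \<noteq> 0" by (simp add: cartan_def)
  note EF = K_id_step[OF assms(1,1) this assms(3)]
  assume "f i b \<noteq> None"
  then obtain b' where b': "f i b = Some b'" by blast
  have "s.highest (int 0) (v b)"
    unfolding s.highest_def using EF(1) assms(3) v_in_V[OF assms(2)] by simp
  then have "kashiwara_f V (E i) (F i) (K i) (v b) = 0"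
    using s.kashiwara_f_highest bspec[OF EF(2) v_in_V[OF assms(2)]] by metis
  then have "0 - v b' \<in> scl q ` L"
    using crystal_f(2)[OF assms(1,2) b'] by simp
  moreover have "0 \<in> scl q ` L"
    using zero_in_L qvs.scale_zero_right by (metis imageI)
  ultimately have "0 - (0 - v b') \<in> scl q ` L"
    using qL_diff by blast
  then show False
    unfolding diff_0 diff_minus_eq_add add_0_left
    using v_not_in_qL[OF crystal_f(3)[OF assms(1,2) b']] by blast
qed

end

text \<open>The identity spreads from \<open>K\<^sub>1\<close> along the edges of the diagram, in the order
  \<open>1, 3, 4\<close>, then \<open>2\<close> and \<open>5, 6\<close>.\<close>

lemma E6_crystal_trivial:
  assumes "E6_crystal B e f" "\<forall>b\<in>B. f 1 b = f 6 b" "i \<in> E6_nodes" "b \<in> B"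
  shows "f i b = None"
proof -
  obtain V E F K K' L v where "Uq_module E6_nodes affine_E6 V E F K K'"
    "crystal_base E6_nodes V E F K L B v e f"
    using assms(1) unfolding E6_crystal_def classical_crystal_def by blast
  then interpret crystal_module E6_nodes affine_E6 V E F K K' L B v e f
    by (rule crystal_module.intro)
  have nodes: "1 \<in> E6_nodes" "6 \<in> E6_nodes" "2 \<in> E6_nodes" "3 \<in> E6_nodes" "4 \<in> E6_nodes" "5 \<in> E6_nodes"
    by (simp_all add: E6_nodes_def)
  have "{1, 6} \<notin> affine_E6"
    by (simp add: affine_E6_def doubleton_eq_iff)
  then have wt: "wt b 1 = 0" if "b \<in> B" for b
    using equal_operators_weight_0[OF nodes(1,2) _ _ assms(2) that] by simp
  have 1: "\<forall>x\<in>V. K 1 x = x"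
  proof (intro ballI K_id_by_weight_vectors[OF nodes(1)])
    fix n x assume "x \<in> V" "x \<noteq> 0" "K 1 x = scl (q powi n) x"
    then obtain b where "b \<in> B" "wt b 1 = n"
      using weight_of_basis_element[OF nodes(1,1)] by blast
    with wt show "n = 0" by simp
  qed
  have edges: "cartan affine_E6 1 3 \<noteq> 0" "cartan affine_E6 3 4 \<noteq> 0"
    "cartan affine_E6 4 2 \<noteq> 0" "cartan affine_E6 4 5 \<noteq> 0" "cartan affine_E6 5 6 \<noteq> 0"
    by (simp_all add: cartan_def affine_E6_def)
  note 3 = K_id_step(3)[OF nodes(1,4) edges(1) 1]
  note 4 = K_id_step(3)[OF nodes(4,5) edges(2) 3]
  note 2 = K_id_step(3)[OF nodes(5,3) edges(3) 4]
  note 5 = K_id_step(3)[OF nodes(5,6) edges(4) 4]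
  note 6 = K_id_step(3)[OF nodes(6,2) edges(5) 5]
  have "i \<in> {1, 2, 3, 4, 5, 6}"
    using assms(3) by (auto simp: E6_nodes_def)
  then have "\<forall>x\<in>V. K i x = x"
    using 1 2 3 4 5 6 by (elim insertE) (simp_all only: empty_iff)
  then show ?thesis
    by (rule f_None_if_K_id[OF assms(3,4)])
qed

section \<open>Transport of crystals\<close>

lemma weight_vectors_reindex:
  assumes "t ` J \<subseteq> I"
  shows "weight_vectors I K \<subseteq> weight_vectors J (\<lambda>i. K (t i))"
proof
  fix x assume "x \<in> weight_vectors I K"
  then obtain w where w: "\<forall>i\<in>I. K i x = scl (q powi w i) x"
    unfolding weight_vectors_def by blast
  then have "\<forall>i\<in>J. K (t i) x = scl (q powi w (t i)) x"
    using assms by blast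
  then show "x \<in> weight_vectors J (\<lambda>i. K (t i))"
    unfolding weight_vectors_def mem_Collect_eq by (rule exI[of _ "\<lambda>i. w (t i)"])
qed

lemma weight_graded_reindex:
  assumes "t ` J \<subseteq> I" "weight_graded I K X"
  shows "weight_graded J (\<lambda>i. K (t i)) X"
  unfolding weight_graded_def
proof
  fix x assume "x \<in> X"
  then obtain W where "finite W" "W \<subseteq> X \<inter> weight_vectors I K" "x = \<Sum>W"
    using assms(2) unfolding weight_graded_def by blast
  moreover from this have "W \<subseteq> X \<inter> weight_vectors J (\<lambda>i. K (t i))"
    using weight_vectors_reindex[OF assms(1)] by blast
  ultimately show "\<exists>W. finite W \<and> W \<subseteq> X \<inter> weight_vectors J (\<lambda>i. K (t i)) \<and> x = \<Sum>W"
    by blast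
qed

lemma cartan_reindex:
  assumes "inj_on t J" "\<forall>i\<in>J. \<forall>j\<in>J. {t i, t j} \<in> D \<longleftrightarrow> {i, j} \<in> D" "i \<in> J" "j \<in> J"
  shows "cartan D (t i) (t j) = cartan D i j"
  using assms inj_on_eq_iff[OF assms(1,3,4)] unfolding cartan_def by simp

lemma quantum_serre_reindex:
  assumes t: "t ` J \<subseteq> I" "inj_on t J" "\<forall>i\<in>J. \<forall>j\<in>J. {t i, t j} \<in> D \<longleftrightarrow> {i, j} \<in> D"
    and "quantum_serre I D V X"
  shows "quantum_serre J D V (\<lambda>i. X (t i))"
  unfolding quantum_serre_def
proof (intro ballI impI)
  fix i j x assume ij: "i \<in> J" "j \<in> J" "i \<noteq> j" "x \<in> V"
  then have "t i \<in> I" "t j \<in> I" "t i \<noteq> t j"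
    using t(1) inj_on_eq_iff[OF t(2) ij(1,2)] by auto
  from bspec[OF mp[OF bspec[OF bspec[OF assms(4)[unfolded quantum_serre_def] this(1)] this(2)] this(3)] ij(4)]
  show "let m = nat (1 - cartan D i j) in
        (\<Sum>k\<le>m. scl ((-1) ^ k * (qfact m / (qfact k * qfact (m - k))))
            ((X (t i) ^^ (m - k)) (X (t j) ((X (t i) ^^ k) x)))) = 0"
    unfolding cartan_reindex[OF t(2,3) ij(1,2)] .
qed

lemma Uq_module_reindex:
  assumes t: "t ` J \<subseteq> I" "inj_on t J" "\<forall>i\<in>J. \<forall>j\<in>J. {t i, t j} \<in> D \<longleftrightarrow> {i, j} \<in> D"
    and "Uq_module I D V E F K K'"
  shows "Uq_module J D V (\<lambda>i. E (t i)) (\<lambda>i. F (t i)) (\<lambda>i. K (t i)) (\<lambda>i. K' (t i))"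
proof -
  note m = assms(4)[unfolded Uq_module_def]
  note mod = m[THEN conjunct1] m[THEN conjunct2, THEN conjunct1]
    m[THEN conjunct2, THEN conjunct2, THEN conjunct1]
    m[THEN conjunct2, THEN conjunct2, THEN conjunct2, THEN conjunct1]
    m[THEN conjunct2, THEN conjunct2, THEN conjunct2, THEN conjunct2, THEN conjunct1]
    m[THEN conjunct2, THEN conjunct2, THEN conjunct2, THEN conjunct2, THEN conjunct2, THEN conjunct1]
    m[THEN conjunct2, THEN conjunct2, THEN conjunct2, THEN conjunct2, THEN conjunct2, THEN conjunct2]
  have tI: "t i \<in> I" if "i \<in> J" for i using t(1) that by blast
  show ?thesis
    unfolding Uq_module_def
  proof (intro conjI mod(1) quantum_serre_reindex[OF t] mod(5,6) weight_graded_reindex[OF t(1)] mod(7))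
    show "\<forall>i\<in>J. \<forall>X\<in>{E (t i), F (t i), K (t i), K' (t i)}. Vector_Spaces.linear scl scl X \<and> X ` V \<subseteq> V"
      using bspec[OF mod(2) tI] by (rule ballI)
    show "\<forall>i\<in>J. \<forall>x\<in>V. K (t i) (K' (t i) x) = x \<and> K' (t i) (K (t i) x) = x"
      using bspec[OF mod(3) tI] by (rule ballI)
    show "\<forall>i\<in>J. \<forall>j\<in>J. \<forall>x\<in>V.
        K (t i) (K (t j) x) = K (t j) (K (t i) x) \<and>
        K (t i) (E (t j) x) = scl (q powi cartan D i j) (E (t j) (K (t i) x)) \<and>
        K (t i) (F (t j) x) = scl (q powi (- cartan D i j)) (F (t j) (K (t i) x)) \<and>
        E (t i) (F (t j) x) - F (t j) (E (t i) x) =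
          (if i = j then scl (1 / (q - inverse q)) (K (t i) x - K' (t i) x) else 0)"
    proof (intro ballI)
      fix i j x assume ij: "i \<in> J" "j \<in> J" "x \<in> V"
      from bspec[OF bspec[OF bspec[OF mod(4) tI[OF ij(1)]] tI[OF ij(2)]] ij(3)]
      show "K (t i) (K (t j) x) = K (t j) (K (t i) x) \<and>
        K (t i) (E (t j) x) = scl (q powi cartan D i j) (E (t j) (K (t i) x)) \<and>
        K (t i) (F (t j) x) = scl (q powi (- cartan D i j)) (F (t j) (K (t i) x)) \<and>
        E (t i) (F (t j) x) - F (t j) (E (t i) x) =
          (if i = j then scl (1 / (q - inverse q)) (K (t i) x - K' (t i) x) else 0)"
        unfolding cartan_reindex[OF t(2,3) ij(1,2)] inj_on_eq_iff[OF t(2) ij(1,2)] .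
    qed
  qed
qed

lemma crystal_base_reindex:
  fixes r :: "'c \<Rightarrow> 'b" and r' :: "'b \<Rightarrow> 'c"
  assumes t: "t ` J \<subseteq> I"
    and r: "\<forall>b\<in>B'. r b \<in> B \<and> r' (r b) = b" "\<forall>b\<in>B. r' b \<in> B' \<and> r (r' b) = b"
    and base: "crystal_base I V E F K L B v e f"
  shows "crystal_base J V (\<lambda>i. E (t i)) (\<lambda>i. F (t i)) (\<lambda>i. K (t i)) L B' (\<lambda>b. v (r b))
    (\<lambda>i b. map_option r' (e (t i) (r b))) (\<lambda>i b. map_option r' (f (t i) (r b)))"
proof -
  note m = base[unfolded crystal_base_def]
  note cb = m[THEN conjunct1] m[THEN conjunct2, THEN conjunct1]
    m[THEN conjunct2, THEN conjunct2, THEN conjunct1]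
    m[THEN conjunct2, THEN conjunct2, THEN conjunct2, THEN conjunct1]
    m[THEN conjunct2, THEN conjunct2, THEN conjunct2, THEN conjunct2, THEN conjunct1]
    m[THEN conjunct2, THEN conjunct2, THEN conjunct2, THEN conjunct2, THEN conjunct2, THEN conjunct1]
    m[THEN conjunct2, THEN conjunct2, THEN conjunct2, THEN conjunct2, THEN conjunct2, THEN conjunct2]
  have bij: "bij_betw r B' B"
    by (rule bij_betw_byWitness[of _ r']) (use r in auto)
  have tI: "t i \<in> I" if "i \<in> J" for i using t that by blast
  have closed: "b' \<in> B" if "i \<in> I" "b \<in> B" "e i b = Some b' \<or> f i b = Some b'" for i b b'
    using bspec[OF bspec[OF cb(6) that(1)] that(2)] that(3)
    by (elim disjE) simp_all
  note l = cb(1)[unfolded crystal_lattice_def]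
  note lat = l[THEN conjunct1] l[THEN conjunct2, THEN conjunct1] l[THEN conjunct2, THEN conjunct2]
  have sum: "(\<Sum>b\<in>B'. scl (of_rat (c b)) (v (r b))) = (\<Sum>b\<in>B. scl (of_rat (c (r' b))) (v b))" for c :: "'c \<Rightarrow> rat"
  proof -
    have "(\<Sum>b\<in>B'. scl (of_rat (c b)) (v (r b))) = (\<Sum>b\<in>B'. scl (of_rat (c (r' (r b)))) (v (r b)))"
      using r(1) by (intro sum.cong) simp_all
    also have "\<dots> = (\<Sum>b\<in>B. scl (of_rat (c (r' b))) (v b))"
      by (rule sum.reindex_bij_betw[OF bij])
    finally show ?thesis .
  qed
  show ?thesis
    unfolding crystal_base_def
  proof (intro conjI)
    show "crystal_lattice J V (\<lambda>i. E (t i)) (\<lambda>i. F (t i)) (\<lambda>i. K (t i)) L"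
      unfolding crystal_lattice_def
    proof (intro conjI weight_graded_reindex[OF t] lat(1,2))
      show "\<forall>i\<in>J. \<forall>x\<in>L. kashiwara_e V (E (t i)) (F (t i)) (K (t i)) x \<in> L \<and>
          kashiwara_f V (E (t i)) (F (t i)) (K (t i)) x \<in> L"
        using bspec[OF lat(3) tI] by (rule ballI)
    qed
    show "finite B'"
      using bij_betw_finite[OF bij] cb(2) by blast
    show "\<forall>b\<in>B'. v (r b) \<in> L \<inter> weight_vectors J (\<lambda>i. K (t i))"
      using cb(3) r(1) weight_vectors_reindex[OF t] by blast
    show "\<forall>x\<in>L. \<exists>c :: 'c \<Rightarrow> rat. x - (\<Sum>b\<in>B'. scl (of_rat (c b)) (v (r b))) \<in> scl q ` L"
    proof
      fix x assume "x \<in> L"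
      then obtain c :: "'b \<Rightarrow> rat" where c: "x - (\<Sum>b\<in>B. scl (of_rat (c b)) (v b)) \<in> scl q ` L"
        using cb(4) by blast
      have "(\<Sum>b\<in>B'. scl (of_rat (c (r b))) (v (r b))) = (\<Sum>b\<in>B. scl (of_rat (c b)) (v b))"
        by (rule sum.reindex_bij_betw[OF bij])
      with c have "x - (\<Sum>b\<in>B'. scl (of_rat (c (r b))) (v (r b))) \<in> scl q ` L" by simp
      then show "\<exists>c :: 'c \<Rightarrow> rat. x - (\<Sum>b\<in>B'. scl (of_rat (c b)) (v (r b))) \<in> scl q ` L"
        by (rule exI[of _ "\<lambda>b. c (r b)"])
    qed
    show "\<forall>c :: 'c \<Rightarrow> rat. (\<Sum>b\<in>B'. scl (of_rat (c b)) (v (r b))) \<in> scl q ` L \<longrightarrow> (\<forall>b\<in>B'. c b = 0)"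
    proof (intro allI impI ballI)
      fix c :: "'c \<Rightarrow> rat" and b
      assume "(\<Sum>b\<in>B'. scl (of_rat (c b)) (v (r b))) \<in> scl q ` L" and b: "b \<in> B'"
      then have "\<forall>b\<in>B. c (r' b) = 0"
        unfolding sum using spec[OF cb(5), of "\<lambda>b. c (r' b)"] by blast
      then show "c b = 0" using r(1) b by metis
    qed
    show "\<forall>i\<in>J. \<forall>b\<in>B'. (case map_option r' (e (t i) (r b)) of
           None \<Rightarrow> kashiwara_e V (E (t i)) (F (t i)) (K (t i)) (v (r b)) \<in> scl q ` L
         | Some b' \<Rightarrow> b' \<in> B' \<and> kashiwara_e V (E (t i)) (F (t i)) (K (t i)) (v (r b)) - v (r b') \<in> scl q ` L) \<and>
        (case map_option r' (f (t i) (r b)) of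
           None \<Rightarrow> kashiwara_f V (E (t i)) (F (t i)) (K (t i)) (v (r b)) \<in> scl q ` L
         | Some b' \<Rightarrow> b' \<in> B' \<and> kashiwara_f V (E (t i)) (F (t i)) (K (t i)) (v (r b)) - v (r b') \<in> scl q ` L)"
    proof (intro ballI)
      fix i b assume ib: "i \<in> J" "b \<in> B'"
      then have "r b \<in> B" using r(1) by blast
      from bspec[OF bspec[OF cb(6) tI[OF ib(1)]] this]
      show "(case map_option r' (e (t i) (r b)) of
           None \<Rightarrow> kashiwara_e V (E (t i)) (F (t i)) (K (t i)) (v (r b)) \<in> scl q ` L
         | Some b' \<Rightarrow> b' \<in> B' \<and> kashiwara_e V (E (t i)) (F (t i)) (K (t i)) (v (r b)) - v (r b') \<in> scl q ` L) \<and>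
        (case map_option r' (f (t i) (r b)) of
           None \<Rightarrow> kashiwara_f V (E (t i)) (F (t i)) (K (t i)) (v (r b)) \<in> scl q ` L
         | Some b' \<Rightarrow> b' \<in> B' \<and> kashiwara_f V (E (t i)) (F (t i)) (K (t i)) (v (r b)) - v (r b') \<in> scl q ` L)"
        using r(2) by (simp split: option.splits)
    qed
    show "\<forall>i\<in>J. \<forall>b\<in>B'. \<forall>b'\<in>B'. map_option r' (f (t i) (r b)) = Some b' \<longleftrightarrow>
        map_option r' (e (t i) (r b')) = Some b"
    proof (intro ballI)
      fix i b b' assume ib: "i \<in> J" "b \<in> B'" "b' \<in> B'"
      then have rB: "r b \<in> B" "r b' \<in> B" using r(1) by blast+
      have "map_option r' (f (t i) (r b)) = Some b' \<longleftrightarrow> f (t i) (r b) = Some (r b')"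
        using closed[OF tI[OF ib(1)] rB(1)] r ib by (cases "f (t i) (r b)") auto
      also have "\<dots> \<longleftrightarrow> e (t i) (r b') = Some (r b)"
        using cb(7) tI[OF ib(1)] rB by blast
      also have "\<dots> \<longleftrightarrow> map_option r' (e (t i) (r b')) = Some b"
        using closed[OF tI[OF ib(1)] rB(2)] r ib by (cases "e (t i) (r b')") auto
      finally show "map_option r' (f (t i) (r b)) = Some b' \<longleftrightarrow>
        map_option r' (e (t i) (r b')) = Some b" .
    qed
  qed
qed

text \<open>With \<open>t\<close> and \<open>r\<close> identities this is the restriction to fewer nodes; in general it pulls a crystal
  back along an embedding \<open>t\<close> of diagrams and a bijection \<open>r\<close> of vertices with inverse \<open>r'\<close>.\<close>

lemma classical_crystal_transport:
  assumes "t ` J \<subseteq> I" "inj_on t J" "\<forall>i\<in>J. \<forall>j\<in>J. {t i, t j} \<in> D \<longleftrightarrow> {i, j} \<in> D"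
    and "\<forall>b\<in>B'. r b \<in> B \<and> r' (r b) = b" "\<forall>b\<in>B. r' b \<in> B' \<and> r (r' b) = b"
    and "classical_crystal I D B e f"
  shows "classical_crystal J D B' (\<lambda>i b. map_option r' (e (t i) (r b))) (\<lambda>i b. map_option r' (f (t i) (r b)))"
proof -
  obtain V E F K K' L v where "Uq_module I D V E F K K'" "crystal_base I V E F K L B v e f"
    using assms(6) unfolding classical_crystal_def by blast
  note Uq_module_reindex[OF assms(1-3) this(1)] crystal_base_reindex[OF assms(1,4,5) this(2)]
  then show ?thesis unfolding classical_crystal_def by blast
qed

lemma classical_crystal_f_closed:
  assumes "classical_crystal I D B e f" "i \<in> I" "b \<in> B" "f i b = Some b'"
  shows "b' \<in> B"
proof -
  obtain V E F K K' L v where "Uq_module I D V E F K K'" "crystal_base I V E F K L B v e f"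
    using assms(1) unfolding classical_crystal_def by blast
  then interpret crystal_module I D V E F K K' L B v e f by (rule crystal_module.intro)
  show ?thesis by (rule crystal_f(3)[OF assms(2-4)])
qed

section \<open>Affine structures on crystals of type $E_6$\<close>

text \<open>Pairs of nodes without \<open>0\<close> are restrictions of the given crystal.\<close>

lemma affine_structure_from_rank_two:
  fixes f0 :: "'b \<Rightarrow> 'b option"
  assumes "E6_crystal B e f"
    and "\<And>j. j \<in> E6_nodes \<Longrightarrow> \<exists>e' f'. classical_crystal {0, j} affine_E6 B e' f' \<and>
      (\<forall>b\<in>B. f' 0 b = f0 b) \<and> (\<forall>b\<in>B. f' j b = f j b)"
  shows "\<exists>G. combinatorial_affine_structure B f G \<and> G 0 = arrows B f0"
proof -
  define G where "G i = (if i = 0 then arrows B f0 else arrows B (f i))" for i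
  have G0: "G 0 = arrows B f0" by (simp add: G_def)
  have G: "G i = arrows B (f i)" if "i \<in> E6_nodes" for i
    using that by (auto simp: G_def E6_nodes_def)
  have arrows_cong: "arrows B g = arrows B h" if "\<forall>b\<in>B. g b = h b" for g h :: "'b \<Rightarrow> 'b option"
    using that unfolding arrows_def by auto
  have "combinatorial_affine_structure B f G"
    unfolding combinatorial_affine_structure_def regular_graph_def
  proof (intro conjI ballI allI impI)
    fix J :: "nat set" assume J: "J \<subseteq> affine_E6_nodes" "card J = 2"
    show "\<exists>e f. classical_crystal J affine_E6 B e f \<and> (\<forall>i\<in>J. G i = arrows B (f i))"
    proof (cases "0 \<in> J")
      case False
      have "J \<subseteq> E6_nodes"
      proof
        fix i assume "i \<in> J"
        with J(1) have "i \<in> {0..6}" unfolding affine_E6_nodes_def by (rule subsetD)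
        moreover have "i \<noteq> 0" using False \<open>i \<in> J\<close> by metis
        ultimately show "i \<in> E6_nodes" by (simp add: E6_nodes_def)
      qed
      then have "classical_crystal J affine_E6 B (\<lambda>i b. map_option id (e (id i) (id b)))
          (\<lambda>i b. map_option id (f (id i) (id b)))"
        using assms(1) unfolding E6_crystal_def
        by (intro classical_crystal_transport[where t = id and r = id and I = E6_nodes and B = B]) auto
      then have "classical_crystal J affine_E6 B e f"
        by (simp only: option.map_id id_apply)
      moreover have "\<forall>i\<in>J. G i = arrows B (f i)" using G \<open>J \<subseteq> E6_nodes\<close> by blast
      ultimately show ?thesis by (intro exI conjI)
    next
      case True
      then have "card (J - {0}) = 1" using J(2) by simp
      then obtain j where j0: "J - {0} = {j}" by (rule card_1_singletonE)
      then have j: "J = {0, j}" using insert_Diff[OF True] by metis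
      have "j \<in> J - {0}" unfolding j0 by (rule singletonI)
      then have "j \<in> J" "j \<noteq> 0" by simp_all
      moreover from this have "j \<in> {0..6}" using J(1)[unfolded affine_E6_nodes_def] by (elim subsetD)
      ultimately have jE: "j \<in> E6_nodes" by (simp add: E6_nodes_def)
      from assms(2)[OF jE] obtain e' f' where ef: "classical_crystal {0, j} affine_E6 B e' f'"
        "\<forall>b\<in>B. f' 0 b = f0 b" "\<forall>b\<in>B. f' j b = f j b" by blast
      have "G 0 = arrows B (f' 0)" "G j = arrows B (f' j)"
        using arrows_cong[OF ef(2)] arrows_cong[OF ef(3)] G[OF jE] by (simp_all add: G_def)
      then have "\<forall>i\<in>J. G i = arrows B (f' i)" unfolding j by simp
      with ef(1) show ?thesis unfolding j by (intro exI conjI)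
    qed
  qed (rule G)
  with G0 show ?thesis by (intro exI[of _ G] conjI)
qed

lemma affine_E6_edge_iff:
  assumes "i \<in> affine_E6_nodes" "j \<in> affine_E6_nodes"
  shows "{i, j} \<in> affine_E6 \<longleftrightarrow> (i, j) \<in> {(1,3), (3,1), (3,4), (4,3), (4,5), (5,4), (5,6), (6,5),
    (4,2), (2,4), (2,0), (0,2)}"
  by (auto simp: affine_E6_def doubleton_eq_iff)

lemma affine_E6_no_loop: "{i} \<notin> affine_E6"
  by (auto simp: affine_E6_def)

text \<open>Each of the nodes \<open>0, 1, 6\<close> has only one neighbour, and automorphisms preserve this.\<close>

lemma affine_E6_automorphism_leaf:
  assumes s: "diagram_automorphism affine_E6_nodes affine_E6 s" and i: "i \<in> {0, 1, 6}"
  shows "s i \<in> {0, 1, 6}"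
proof -
  have bij: "bij_betw s affine_E6_nodes affine_E6_nodes"
    and edge: "\<forall>i\<in>affine_E6_nodes. \<forall>j\<in>affine_E6_nodes. {s i, s j} \<in> affine_E6 \<longleftrightarrow> {i, j} \<in> affine_E6"
    using s unfolding diagram_automorphism_def by (rule conjunct1, rule conjunct2)
  have iN: "i \<in> affine_E6_nodes" using i by (auto simp: affine_E6_nodes_def)
  have leaf: "a = b" if ab: "a \<in> affine_E6_nodes" "b \<in> affine_E6_nodes" "{s i, a} \<in> affine_E6" "{s i, b} \<in> affine_E6" for a b
  proof -
    have "a \<in> s ` affine_E6_nodes" "b \<in> s ` affine_E6_nodes"
      unfolding bij_betw_imp_surj_on[OF bij] by (rule ab(1), rule ab(2))
    then obtain a' b' where a'b': "a' \<in> affine_E6_nodes" "a = s a'" "b' \<in> affine_E6_nodes" "b = s b'"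
      by (elim imageE)
    have "{i, a'} \<in> affine_E6" "{i, b'} \<in> affine_E6"
      using bspec[OF bspec[OF edge iN] a'b'(1)] bspec[OF bspec[OF edge iN] a'b'(3)] ab(3,4)
      unfolding a'b' by iprover+
    then have "a' = b'"
      using i unfolding affine_E6_edge_iff[OF iN a'b'(1)] affine_E6_edge_iff[OF iN a'b'(3)] by auto
    with a'b' show ?thesis by simp
  qed
  have edges: "{2, 0} \<in> affine_E6" "{2, 4} \<in> affine_E6" "{3, 1} \<in> affine_E6" "{3, 4} \<in> affine_E6"
    "{4, 2} \<in> affine_E6" "{4, 3} \<in> affine_E6" "{5, 4} \<in> affine_E6" "{5, 6} \<in> affine_E6"
    by (simp_all add: affine_E6_edge_iff affine_E6_nodes_def)
  have nodes: "{0, 1, 2, 3, 4, 6} \<subseteq> affine_E6_nodes"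
    by (simp add: affine_E6_nodes_def)
  have "s i \<in> affine_E6_nodes" using bij iN unfolding bij_betw_def by blast
  then have "s i \<in> {0, 1, 2, 3, 4, 5, 6}" by (auto simp: affine_E6_nodes_def)
  moreover have "s i \<noteq> 2"
  proof
    assume "s i = 2"
    then have "{s i, 0} \<in> affine_E6" "{s i, 4} \<in> affine_E6" using edges by simp_all
    then have "0 = (4 :: nat)" using nodes by (intro leaf) auto
    then show False by simp
  qed
  moreover have "s i \<noteq> 3"
  proof
    assume "s i = 3"
    then have "{s i, 1} \<in> affine_E6" "{s i, 4} \<in> affine_E6" using edges by simp_all
    then have "1 = (4 :: nat)" using nodes by (intro leaf) auto
    then show False by simp
  qed
  moreover have "s i \<noteq> 4"
  proof
    assume "s i = 4"
    then have "{s i, 2} \<in> affine_E6" "{s i, 3} \<in> affine_E6" using edges by simp_all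
    then have "2 = (3 :: nat)" using nodes by (intro leaf) auto
    then show False by simp
  qed
  moreover have "s i \<noteq> 5"
  proof
    assume "s i = 5"
    then have "{s i, 4} \<in> affine_E6" "{s i, 6} \<in> affine_E6" using edges by simp_all
    then have "4 = (6 :: nat)" using nodes by (intro leaf) auto
    then show False by simp
  qed
  ultimately show ?thesis by blast
qed

theorem theorem3p9:
  fixes B :: "'b set" and e f :: "nat \<Rightarrow> 'b \<Rightarrow> 'b option"
    and p :: "'b \<Rightarrow> 'b" and s :: "nat \<Rightarrow> nat"
  assumes "E6_crystal B e f"
    and "diagram_automorphism affine_E6_nodes affine_E6 s"
    and "twisted_isomorphism s p B e f B e f"
    and "\<forall>b\<in>B. map_option p (f 1 b) = f 6 (p b)"
    and "has_order_on B p 3"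
  shows "\<exists>G. combinatorial_affine_structure B f G \<and>
           G 0 = arrows B (\<lambda>b. map_option (p ^^ 2) (f 1 (p b)))"
proof (rule affine_structure_from_rank_two[OF assms(1)])
  fix j assume j: "j \<in> E6_nodes"
  have crystal: "classical_crystal E6_nodes affine_E6 B e f"
    using assms(1) unfolding E6_crystal_def .
  have nodes: "1 \<in> E6_nodes" "6 \<in> E6_nodes" by (simp_all add: E6_nodes_def)
  have pB: "p b \<in> B" if "b \<in> B" for b
    using assms(3) that unfolding twisted_isomorphism_def bij_betw_def by blast
  have p3: "p (p (p b)) = b" if "b \<in> B" for b
    using assms(5) that unfolding has_order_on_def by (auto simp: numeral_3_eq_3)
  have p_map: "map_option p (f i b) = f (s i) (p b)" if "i \<in> E6_nodes" "s i \<noteq> 0" "b \<in> B" for i b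
    using assms(3) that unfolding twisted_isomorphism_def by blast
  have p16: "map_option p (f 1 b) = f 6 (p b)" if "b \<in> B" for b
    using assms(4) that by blast
  have closed: "c \<in> B" if "i \<in> E6_nodes" "b \<in> B" "f i b = Some c" for i b c
    by (rule classical_crystal_f_closed[OF crystal that])
  have map3: "map_option p (map_option p (map_option p (f i b))) = f i b" if "i \<in> E6_nodes" "b \<in> B" for i b
    using closed[OF that] p3 by (cases "f i b") auto
  have square: "map_option p (map_option p y) = map_option (p ^^ 2) y" for y
    by (cases y) (simp_all add: numeral_2_eq_2)
  have sbij: "bij_betw s affine_E6_nodes affine_E6_nodes"
    and sedge: "\<forall>i\<in>affine_E6_nodes. \<forall>j\<in>affine_E6_nodes. {s i, s j} \<in> affine_E6 \<longleftrightarrow> {i, j} \<in> affine_E6"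
    using assms(2) unfolding diagram_automorphism_def by (rule conjunct1, rule conjunct2)
  have leaves: "s 0 \<in> {0, 1, 6}" "s 1 \<in> {0, 1, 6}" "s 6 \<in> {0, 1, 6}"
    using affine_E6_automorphism_leaf[OF assms(2)] by blast+
  have sinj: "inj_on s affine_E6_nodes" using sbij by (rule bij_betw_imp_inj_on)
  then have distinct: "s 0 \<noteq> s 1" "s 0 \<noteq> s 6" "s 1 \<noteq> s 6"
    unfolding inj_on_def affine_E6_nodes_def by fastforce+
  show "\<exists>e' f'. classical_crystal {0, j} affine_E6 B e' f' \<and>
      (\<forall>b\<in>B. f' 0 b = map_option (p ^^ 2) (f 1 (p b))) \<and> (\<forall>b\<in>B. f' j b = f j b)"
  proof (cases "s 1 = 6 \<and> s 6 = 0")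
    case True
    then have s0: "s 0 = 1" using leaves distinct by auto
    show ?thesis
    proof (cases "j = 6")
      case False
      let ?e = "\<lambda>i b. map_option (p ^^ 2) (e (s i) (p b))"
        and ?f = "\<lambda>i b. map_option (p ^^ 2) (f (s i) (p b))"
      have sub: "{0, j} \<subseteq> affine_E6_nodes" using j by (auto simp: E6_nodes_def affine_E6_nodes_def)
      have "s j \<noteq> s 6" using False sinj j unfolding inj_on_def E6_nodes_def affine_E6_nodes_def by auto
      then have sj: "s j \<noteq> 0" using True by simp
      moreover have "s j \<in> affine_E6_nodes" using sbij sub unfolding bij_betw_def by blast
      ultimately have "s ` {0, j} \<subseteq> E6_nodes"
        using s0 by (auto simp: E6_nodes_def affine_E6_nodes_def)
      moreover have "inj_on s {0, j}" by (rule inj_on_subset[OF sinj sub])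
      moreover have "\<forall>i\<in>{0, j}. \<forall>k\<in>{0, j}. {s i, s k} \<in> affine_E6 \<longleftrightarrow> {i, k} \<in> affine_E6"
        using sedge sub by blast
      moreover have "\<forall>b\<in>B. p b \<in> B \<and> (p ^^ 2) (p b) = b" "\<forall>b\<in>B. (p ^^ 2) b \<in> B \<and> p ((p ^^ 2) b) = b"
        using pB p3 by (simp_all add: numeral_2_eq_2)
      ultimately have crystal': "classical_crystal {0, j} affine_E6 B ?e ?f"
        by (intro classical_crystal_transport[where t = s and r = p and B = B and I = E6_nodes] crystal)
      have "?f 0 b = map_option (p ^^ 2) (f 1 (p b))" for b
        by (simp only: s0)
      moreover have "?f j b = f j b" if "b \<in> B" for b
        using map3[OF j that] unfolding p_map[OF j sj that, symmetric] square[symmetric] .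
      ultimately show ?thesis
        by (intro exI[of _ ?e] exI[of _ ?f] conjI crystal' ballI)
    next
      case j6: True
      (* s would send 6 to 0; the square of s sends 0 to 6 and 6 to 1. *)
      define t :: "nat \<Rightarrow> nat" where "t i = (if i = 0 then 6 else 1)" for i
      let ?e = "\<lambda>i b. map_option p (e (t i) ((p ^^ 2) b))"
        and ?f = "\<lambda>i b. map_option p (f (t i) ((p ^^ 2) b))"
      have "t ` {0, j} \<subseteq> E6_nodes" unfolding t_def using nodes by auto
      moreover have "inj_on t {0, j}" unfolding t_def inj_on_def using j6 by auto
      moreover have "\<forall>i\<in>{0, j}. \<forall>k\<in>{0, j}. {t i, t k} \<in> affine_E6 \<longleftrightarrow> {i, k} \<in> affine_E6"
        unfolding t_def j6 by (simp add: affine_E6_edge_iff affine_E6_nodes_def affine_E6_no_loop)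
      moreover have "\<forall>b\<in>B. (p ^^ 2) b \<in> B \<and> p ((p ^^ 2) b) = b" "\<forall>b\<in>B. p b \<in> B \<and> (p ^^ 2) (p b) = b"
        using pB p3 by (simp_all add: numeral_2_eq_2)
      ultimately have crystal': "classical_crystal {0, j} affine_E6 B ?e ?f"
        by (intro classical_crystal_transport[where t = t and r = "p ^^ 2" and B = B and I = E6_nodes] crystal)
      have "?f 0 b = map_option (p ^^ 2) (f 1 (p b))" if "b \<in> B" for b
      proof -
        have "t 0 = 6" "(p ^^ 2) b = p (p b)" by (simp_all add: t_def numeral_2_eq_2)
        then show ?thesis
          by (simp only: p16[OF pB[OF that], symmetric] square)
      qed
      moreover have "?f j b = f j b" if "b \<in> B" for b
      proof -
        have "t 6 = 1" "(p ^^ 2) b = p (p b)" by (simp_all add: t_def numeral_2_eq_2)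
        then show ?thesis
          by (simp only: j6 p16[OF pB[OF pB[OF that]]] p3[OF that])
      qed
      ultimately show ?thesis
        by (intro exI[of _ ?e] exI[of _ ?f] conjI crystal' ballI)
    qed
  next
    case degenerate: False
    have f16: "f 1 b = f 6 b" if b: "b \<in> B" for b
    proof -
      have pp: "p (p b) \<in> B" using pB b by blast
      (* These are the permutations of the leaves other than 1 to 6 to 0 to 1. *)
      consider "s 1 = 1" | "s 6 = 6" | "s 6 = 1"
        using leaves(2,3) distinct(3) degenerate by (metis insert_iff empty_iff)
      then show ?thesis
      proof cases
        case 1
        then have "map_option p (f 1 (p (p b))) = f 1 (p (p (p b)))"
          using p_map[OF nodes(1) _ pp] by simp
        then show ?thesis
          unfolding p16[OF pp] p3[OF b] by (rule sym)
      next
        case 2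
        then have "map_option p (f 6 b) = f 6 (p b)"
          using p_map[OF nodes(2) _ b] by simp
        then have "map_option p (f 1 b) = map_option p (f 6 b)"
          unfolding p16[OF b] by (rule sym)
        then have "map_option p (map_option p (map_option p (f 1 b)))
            = map_option p (map_option p (map_option p (f 6 b)))"
          by (rule arg_cong[where f = "\<lambda>y. map_option p (map_option p y)"])
        then show ?thesis unfolding map3[OF nodes(1) b] map3[OF nodes(2) b] .
      next
        case 3
        then have p61: "map_option p (f 6 c) = f 1 (p c)" if "c \<in> B" for c
          using p_map[OF nodes(2) _ that] by simp
        have "f 6 b = map_option p (f 1 (p (p b)))"
          unfolding p16[OF pp] p3[OF b] ..
        also have "f 1 (p (p b)) = map_option p (map_option p (f 1 b))"
          unfolding p16[OF b] p61[OF pB[OF b]] ..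
        also have "map_option p (map_option p (map_option p (f 1 b))) = f 1 b"
          by (rule map3[OF nodes(1) b])
        finally show ?thesis by (rule sym)
      qed
    qed
    have None: "f i b = None" if "i \<in> E6_nodes" "b \<in> B" for i b
      using E6_crystal_trivial[OF assms(1) _ that] f16 by blast
    (* All operators are trivial, so only the adjacency of the two nodes counts: 1 - 3 is an edge
       like 0 - 2, and 1, 6 are not adjacent. *)
    define t :: "nat \<Rightarrow> nat" where "t i = (if i = 0 then 1 else if j = 2 then 3 else 6)" for i
    let ?e = "\<lambda>i b. map_option id (e (t i) (id b))" and ?f = "\<lambda>i b. map_option id (f (t i) (id b))"
    have t: "t ` {0, j} \<subseteq> E6_nodes" unfolding t_def by (auto simp: E6_nodes_def)
    moreover have "j \<noteq> 0" using j by (simp add: E6_nodes_def)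
    then have "inj_on t {0, j}" unfolding t_def inj_on_def by auto
    moreover have "\<forall>i\<in>{0, j}. \<forall>k\<in>{0, j}. {t i, t k} \<in> affine_E6 \<longleftrightarrow> {i, k} \<in> affine_E6"
      unfolding t_def using j by (auto simp: affine_E6_edge_iff affine_E6_nodes_def E6_nodes_def affine_E6_no_loop)
    ultimately have crystal': "classical_crystal {0, j} affine_E6 B ?e ?f"
      by (intro classical_crystal_transport[where t = t and r = id and B = B and I = E6_nodes] crystal) simp_all
    have t_None: "?f i b = None" if "i \<in> {0, j}" "b \<in> B" for i b
    proof -
      have "t i \<in> E6_nodes" using t that(1) by blast
      then show ?thesis using None that(2) by simp
    qed
    have "f 1 (p b) = None" "f j b = None" if "b \<in> B" for b
      using None[OF nodes(1) pB[OF that]] None[OF j that] by blast+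
    with t_None have "?f 0 b = map_option (p ^^ 2) (f 1 (p b))" "?f j b = f j b" if "b \<in> B" for b
      using that by simp_all
    then show ?thesis
      by (intro exI[of _ ?e] exI[of _ ?f] conjI crystal' ballI)
  qed
qed

end
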